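(* Fix an integer $m \geq 3$. There exists a set $\mathcal{N} \subset (0,\infty)^m$ with zero Lebesgue measure such that \[ p \circ \Lambda_{\boldsymbol{\alpha}} : \mathbb{R} \to \mathbb{R}; \quad x \mapsto p(\Lambda_{\boldsymbol{\alpha}}(x)) \] is not a totally non-negative function, and so not a Pólya frequency function, for any $\boldsymbol{\alpha} \in (0,\infty)^m \setminus \mathcal{N}$ and any non-homothetic real polynomial $p$, that is, any real polynomial not of the form $p(x) = cx$ for some $c > 0$.
   Context: For $\boldsymbol{\alpha} = (\alpha_1, \ldots, \alpha_m) \in (0,\infty)^m$ with $m \geq 2$, $\Lambda_{\boldsymbol{\alpha}} : \mathbb{R} \to [0,\infty)$ denotes the continuous probability density function of $\alpha_1 X_1 + \cdots + \alpha_m X_m$, where $X_1, \ldots, X_m$ are independent standard exponential random variables (mean $1$). Equivalently, it is the unique continuous function with bilateral Laplace transform $\int_{\mathbb{R}} e^{-xs} \Lambda_{\boldsymbol{\alpha}}(x)\,dx = \prod_{j=1}^m (1 + \alpha_j s)^{-1}$ on $\{ s \in \mathbb{C} : \mathrm{Re}\, s > -\alpha_j^{-1} \text{ for } j = 1, \ldots, m \}$. A function $\Lambda : \mathbb{R} \to \mathbb{R}$ is totally non-negative if for every $n \geq 1$ and all reals $x_1 < \cdots < x_n$, $y_1 < \cdots < y_n$ one has $\det(\Lambda(x_i - y_j))_{i,j=1}^n \geq 0$. A Pólya frequency function is a totally non-negative function that is Lebesgue integrable and non-zero at two or more points.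
   Formalization: Non-negative constant polynomials p = c ≥ 0 are exempted from "not totally non-negative", since a constant function c ≥ 0 is totally non-negative; "not a Pólya frequency function" is still proved for them. *)

theory Defs
  imports
    "HOL-Probability.Probability"
    "HOL-Computational_Algebra.Polynomial"
    "Jordan_Normal_Form.Determinant"
begin

no_notation Matrix.vec_index (infixl \<open>$\<close> 100)

text \<open>
  The product measure makes the coordinates independent standard exponential random variables.
  When all coordinates of \<open>\<alpha>\<close> are positive and there are at least two of them, a continuous
  non-negative density exists, and it is unique because two continuous densities that agree
  almost everywhere are equal; the description is not meant to be used outside this range.
\<close>

definition hypoexp_density :: "real ^ 'm \<Rightarrow> real \<Rightarrow> real" where
  "hypoexp_density \<alpha> = (THE f. continuous_on UNIV f \<and> (\<forall>x. 0 \<le> f x) \<and>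
     distributed (\<Pi>\<^sub>M j\<in>UNIV. density lborel (exponential_density 1)) lborel
       (\<lambda>X. \<Sum>j\<in>UNIV. \<alpha> $ j * X j) (\<lambda>x. ennreal (f x)))"

definition totally_nonneg :: "(real \<Rightarrow> real) \<Rightarrow> bool" where
  "totally_nonneg \<Lambda> \<longleftrightarrow>
     (\<forall>n\<ge>1. \<forall>x y :: nat \<Rightarrow> real.
        strict_mono_on {..<n} x \<longrightarrow> strict_mono_on {..<n} y \<longrightarrow>
        0 \<le> Determinant.det (Matrix.mat n n (\<lambda>(i, j). \<Lambda> (x i - y j))))"

definition polya_frequency_function :: "(real \<Rightarrow> real) \<Rightarrow> bool" where
  "polya_frequency_function \<Lambda> \<longleftrightarrow>
     totally_nonneg \<Lambda> \<and> integrable lebesgue \<Lambda> \<and> (\<exists>s t. s \<noteq> t \<and> \<Lambda> s \<noteq> 0 \<and> \<Lambda> t \<noteq> 0)"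

definition homothetic_poly :: "real poly \<Rightarrow> bool" where
  "homothetic_poly p \<longleftrightarrow> (\<exists>c>0. \<forall>x. poly p x = c * x)"

text \<open>
  A non-negative constant polynomial is not homothetic, yet composing with it always gives a
  totally non-negative function. That function is never a Polya frequency function.
\<close>

lemma totally_nonneg_const:
  assumes "0 \<le> c"
  shows "totally_nonneg (\<lambda>_. c)"
  unfolding totally_nonneg_def
proof (intro allI impI)
  fix n :: nat and x y :: "nat \<Rightarrow> real"
  assume n: "1 \<le> n"
  let ?A = "Matrix.mat n n (\<lambda>(i, j). c)"
  have A: "?A \<in> carrier_mat n n" by simp
  show "0 \<le> Determinant.det (Matrix.mat n n (\<lambda>(i, j). c))"
  proof (cases "n = 1")
    case True
    then show ?thesis using assms det_single[of ?A] by simp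
  next
    case False
    then have "Matrix.row ?A 0 = Matrix.row ?A 1" "(0::nat) < n" "1 < n"
      using n by (auto intro!: eq_vecI)
    then show ?thesis using det_identical_rows[OF A, of 0 1] by simp
  qed
qed

lemma not_polya_frequency_function_const: "\<not> polya_frequency_function (\<lambda>_. c)"
proof
  assume pf: "polya_frequency_function (\<lambda>_. c)"
  then have "integrable lborel (\<lambda>_::real. c)" and "c \<noteq> 0"
    by (auto simp: polya_frequency_function_def integrable_completion)
  then show False
    by (auto simp: integrable_iff_bounded ennreal_mult_eq_top_iff ennreal_mult_top)
qed

end

theory Submission
  imports Defs "HOL-Computational_Algebra.Fundamental_Theorem_Algebra"
begin

text \<open>
  Off the null set where the rates \<open>\<beta> j = 1 / \<alpha> $ j\<close> satisfy a non-trivial integer relation, the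
  density is an exponential sum on the positive half-line with \<open>m\<close> non-zero coefficients. If
  \<open>p 0 \<noteq> 0\<close>, the 2 by 2 minors make the composition monotone with equal limits at both ends, hence
  constant. If \<open>p 0 = 0\<close> and \<open>p\<close> has degree \<open>d \<ge> 2\<close>, the composition is an exponential sum with at
  least \<open>d (m - 1) + 2\<close> distinct exponents, because \<open>m \<ge> 3\<close>. By Schoenberg's argument (variation
  diminishing and real-rooted polynomials) the reciprocal of the Laplace transform of a totally
  non-negative exponential sum is entire. Being rational, it is then a polynomial, so an exponential
  sum with \<open>n\<close> exponents vanishes at \<open>0\<close> to order \<open>n - 1\<close>. The composition, however, vanishes to
  order at most \<open>d (m - 1)\<close>.
\<close>

hide_const (open) module.smult

section \<open>Total non-negativity and sign changes\<close>

text \<open>The condition m \<ge> 3 enters through a count. With two distinct rates, the d-th power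
  of the density is a multiple of exp (- a x) (1 - exp (- b x)) ^ d on the half-line: it has d + 1
  exponents, vanishes at 0 to order d, and is itself a Polya frequency function. Order and number of
  exponents match exactly there; a third rate supplies one exponent too many. The count helps only
  if no coefficient cancels. Since p and the density have coefficients of both signs, this is what
  genericity of the rates is for. Testing the kernel on polynomials keeps Schoenberg's argument
  algebraic: convolution acts on them as a power series in D of which finitely many terms matter, so
  P(D) can be inverted formally before anything is known about convergence. Convergence of c = Q / P
  comes afterwards: the roots of c(D) h, for h close to X^n, are real, their sum of squares grows
  like n^2, and the arithmetic-geometric mean inequality bounds n! c_n by a multiple of (M n)^(n/2)
  for some constant M.\<close>

lemma sum_lessThan_Suc_skip:
  fixes g :: "nat \<Rightarrow> 'a::comm_monoid_add"
  assumes "j \<le> q"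
  shows "(\<Sum>b<Suc q. g b) = g j + (\<Sum>b<q. g (if b < j then b else Suc b))"
proof -
  let ?s = "\<lambda>b. if b < j then b else Suc b"
  have img: "{..<Suc q} = insert j (?s ` {..<q})"
  proof
    show "{..<Suc q} \<subseteq> insert j (?s ` {..<q})"
    proof
      fix x assume x: "x \<in> {..<Suc q}"
      consider "x < j" | "x = j" | "j < x" by linarith
      then show "x \<in> insert j (?s ` {..<q})"
      proof cases
        case 1
        then have "x = ?s x" "x \<in> {..<q}" using assms by auto
        then show ?thesis by blast
      next
        case 3
        then have "x = ?s (x - 1)" "x - 1 \<in> {..<q}" using x by auto
        then show ?thesis by blast
      qed auto
    qed
  qed (use assms in auto)
  have inj: "inj_on ?s {..<q}"
    by (auto simp: inj_on_def split: if_splits)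
  have "j \<notin> ?s ` {..<q}" by (auto split: if_splits)
  then have "sum g (insert j (?s ` {..<q})) = g j + sum g (?s ` {..<q})"
    by (intro sum.insert) auto
  also have "sum g (?s ` {..<q}) = (\<Sum>b<q. g (?s b))"
    by (subst sum.reindex[OF inj]) (simp add: o_def)
  finally show ?thesis unfolding img .
qed

text \<open>The cofactors along column \<open>s\<close> do not involve that column, so they can be
  taken from the matrix with zeros there. This linear form lets an integral be moved through a
  determinant.\<close>

lemma det_column_linear:
  fixes A :: "nat \<Rightarrow> nat \<Rightarrow> real"
  assumes s: "s < n"
  obtains \<kappa> where "\<And>col. Determinant.det (Matrix.mat n n (\<lambda>(i, j). if j = s then col i else A i j)) =
    (\<Sum>i<n. col i * \<kappa> i)"
proof
  define M where "M col = Matrix.mat n n (\<lambda>(i, j). if j = s then col i else A i j)" for col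
  fix col :: "nat \<Rightarrow> real"
  have carrier: "M col \<in> carrier_mat n n" for col by (simp add: M_def)
  have "mat_delete (M col) i s = mat_delete (M (\<lambda>_. 0)) i s" if "i < n" for i
    using that s by (intro eq_matI) (auto simp: mat_delete_def M_def)
  then have "cofactor (M col) i s = cofactor (M (\<lambda>_. 0)) i s" if "i < n" for i
    using that by (simp add: cofactor_def)
  then show "Determinant.det (M col) = (\<Sum>i<n. col i * cofactor (M (\<lambda>_. 0)) i s)"
    using s by (subst laplace_expansion_column[OF carrier s]) (auto simp: M_def intro!: sum.cong)
qed

lemma totally_nonneg_nonneg:
  assumes "totally_nonneg f"
  shows "0 \<le> f x"
proof -
  have "0 \<le> Determinant.det (Matrix.mat 1 1 (\<lambda>(i, j). f ((\<lambda>_. x) i - (\<lambda>_. 0) j)))"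
    by (rule assms[unfolded totally_nonneg_def, rule_format]) (auto simp: strict_mono_on_def)
  then show ?thesis by (subst (asm) det_single) auto
qed

text \<open>A matrix with \<open>r\<close> rows and \<open>q\<close> columns is given by its entries \<open>U i j\<close> for \<open>i < r\<close>, \<open>j < q\<close>.\<close>

definition tn_matrix :: "nat \<Rightarrow> nat \<Rightarrow> (nat \<Rightarrow> nat \<Rightarrow> real) \<Rightarrow> bool" where
  "tn_matrix r q U \<longleftrightarrow> (\<forall>k \<rho> \<gamma>. strict_mono_on {..<k} \<rho> \<longrightarrow> \<rho> ` {..<k} \<subseteq> {..<r} \<longrightarrow>
     strict_mono_on {..<k} \<gamma> \<longrightarrow> \<gamma> ` {..<k} \<subseteq> {..<q} \<longrightarrow>
     0 \<le> Determinant.det (Matrix.mat k k (\<lambda>(i, j). U (\<rho> i) (\<gamma> j))))"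

lemma tn_matrixD:
  assumes "tn_matrix r q U" "strict_mono_on {..<k} \<rho>" "\<rho> ` {..<k} \<subseteq> {..<r}"
    "strict_mono_on {..<k} \<gamma>" "\<gamma> ` {..<k} \<subseteq> {..<q}"
  shows "0 \<le> Determinant.det (Matrix.mat k k (\<lambda>(i, j). U (\<rho> i) (\<gamma> j)))"
  using assms unfolding tn_matrix_def by blast

lemma tn_matrix_submatrix:
  assumes U: "tn_matrix r q U" and "strict_mono_on {..<q'} s" "s ` {..<q'} \<subseteq> {..<q}" "r' \<le> r"
  shows "tn_matrix r' q' (\<lambda>a b. U a (s b))"
  unfolding tn_matrix_def
proof (intro allI impI)
  fix k and \<rho> \<gamma> :: "nat \<Rightarrow> nat"
  assume *: "strict_mono_on {..<k} \<rho>" "\<rho> ` {..<k} \<subseteq> {..<r'}"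
     "strict_mono_on {..<k} \<gamma>" "\<gamma> ` {..<k} \<subseteq> {..<q'}"
  have "strict_mono_on {..<k} (\<lambda>j. s (\<gamma> j))"
    using * assms by (auto simp: strict_mono_on_def image_subset_iff)
  moreover have "(\<lambda>j. s (\<gamma> j)) ` {..<k} \<subseteq> {..<q}" using * assms by auto
  moreover have "\<rho> ` {..<k} \<subseteq> {..<r}" using * assms by auto
  ultimately show "0 \<le> Determinant.det (Matrix.mat k k (\<lambda>(i, j). U (\<rho> i) (s (\<gamma> j))))"
    using tn_matrixD[OF U *(1)] by simp
qed

text \<open>The variation diminishing property in its extreme case. Expanding the vanishing determinant
  of the matrix augmented by the image vector shows that the top square block is singular; a
  column that depends on the others is then dropped together with the last row.\<close>

lemma tn_matrix_no_alternation:
  assumes "tn_matrix (Suc q) q U"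
    and "\<And>i. i \<le> q \<Longrightarrow> 0 < (-1) ^ i * (\<Sum>j<q. U i j * c j)"
  shows False
  using assms
proof (induction q arbitrary: U c)
  case 0
  from "0.prems"(2)[of 0] show ?case by simp
next
  case (Suc p)
  define q where "q = Suc p"
  define v where "v i = (\<Sum>j<q. U i j * c j)" for i
  have TN: "tn_matrix (Suc q) q U" and alt: "\<And>i. i \<le> q \<Longrightarrow> 0 < (-1) ^ i * v i"
    using Suc.prems by (simp_all add: q_def v_def)
  define W where "W = Matrix.mat (Suc q) (Suc q) (\<lambda>(i, j). if j < q then U i j else v i)"
  have W: "W \<in> carrier_mat (Suc q) (Suc q)" by (simp add: W_def)
  \<comment> \<open>The last column of \<open>W\<close> is the image of \<open>c\<close>, so
    \<open>(c, -1)\<close> lies in the kernel.\<close>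
  define z where "z = Matrix.vec (Suc q) (\<lambda>j. if j < q then c j else -1)"
  have "W *\<^sub>v z = 0\<^sub>v (Suc q)"
    by (intro eq_vecI) (auto simp: W_def z_def scalar_prod_def v_def atLeast0LessThan)
  moreover have "z \<in> carrier_vec (Suc q)" by (simp add: z_def)
  moreover have "z \<noteq> 0\<^sub>v (Suc q)"
  proof
    assume "z = 0\<^sub>v (Suc q)"
    then have "Matrix.vec_index z q = Matrix.vec_index (0\<^sub>v (Suc q)) q" by simp
    then show False by (simp add: z_def)
  qed
  ultimately have det0: "Determinant.det W = 0"
    using det_0_iff_vec_prod_zero[OF W] by blast
  define m where "m i = Determinant.det (Matrix.mat q q (\<lambda>(a, b). U (if a < i then a else Suc a) b))" for i
  have del: "mat_delete W i q = Matrix.mat q q (\<lambda>(a, b). U (if a < i then a else Suc a) b)" if "i \<le> q" for i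
    using that by (intro eq_matI) (auto simp: mat_delete_def W_def)
  have m_nonneg: "0 \<le> m i" if "i \<le> q" for i
  proof -
    have "0 \<le> Determinant.det (Matrix.mat q q (\<lambda>(a, b). U ((\<lambda>a. if a < i then a else Suc a) a) (id b)))"
      by (rule tn_matrixD[OF TN]) (auto simp: strict_mono_on_def)
    then show ?thesis by (simp add: m_def)
  qed
  \<comment> \<open>The factor \<open>(-1) ^ q\<close> cancels the column part of each cofactor
    sign. A vanishing sum of non-negative terms remains, and the strict sign of \<open>v q\<close>
    forces \<open>m q = 0\<close>.\<close>
  have "0 = (-1) ^ q * Determinant.det W" using det0 by simp
  also have "\<dots> = (-1) ^ q * (\<Sum>i<Suc q. W $$ (i, q) * cofactor W i q)"
    by (subst laplace_expansion_column[OF W, of q]) auto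
  also have "\<dots> = (\<Sum>i<Suc q. (-1) ^ i * v i * m i)"
    unfolding sum_distrib_left
  proof (rule sum.cong)
    fix i assume "i \<in> {..<Suc q}"
    then have i: "i \<le> q" by simp
    have "((-1::real) ^ q * (-1) ^ q) = 1" by (simp flip: power_mult_distrib)
    then show "(-1) ^ q * (W $$ (i, q) * cofactor W i q) = (-1) ^ i * v i * m i"
      using i by (simp add: cofactor_def del m_def power_add) (simp add: W_def)
  qed simp
  finally have "(\<Sum>i<Suc q. (-1) ^ i * v i * m i) = 0" by simp
  moreover have "0 \<le> (-1) ^ i * v i * m i" if "i \<in> {..<Suc q}" for i
    using alt[of i] m_nonneg[of i] that by simp
  ultimately have "\<forall>i\<in>{..<Suc q}. (-1) ^ i * v i * m i = 0"
    by (subst (asm) sum_nonneg_eq_0_iff) auto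
  then have "(-1) ^ q * v q * m q = 0" by blast
  then have "m q = 0" using alt[of q] by auto
  then have "Determinant.det (Matrix.mat q q (\<lambda>(a, b). U a b)) = 0"
    unfolding m_def by (subst (asm) cong_mat[of q q q q _ "\<lambda>(a, b). U a b"]) auto
  then obtain w where w: "w \<in> carrier_vec q" "w \<noteq> 0\<^sub>v q"
      "Matrix.mat q q (\<lambda>(a, b). U a b) *\<^sub>v w = 0\<^sub>v q"
    using det_0_iff_vec_prod_zero[of "Matrix.mat q q (\<lambda>(a, b). U a b)" q] by auto
  define u where "u b = Matrix.vec_index w b" for b
  from w obtain j where j: "j < q" "u j \<noteq> 0"
    unfolding u_def by (metis carrier_vecD eq_vecI index_zero_vec(1) index_zero_vec(2))
  have ker: "(\<Sum>b<q. U a b * u b) = 0" if "a < q" for a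
  proof -
    have "Matrix.vec_index (Matrix.mat q q (\<lambda>(a, b). U a b) *\<^sub>v w) a = 0" using w(3) that by simp
    then show ?thesis using that w(1) by (simp add: scalar_prod_def u_def atLeast0LessThan)
  qed
  define s where "s b = (if b < j then b else Suc b)" for b
  \<comment> \<open>Subtracting \<open>c j / u j\<close> times the kernel vector removes column
    \<open>j\<close> without changing the image in the rows \<open>a < q\<close>. Row
    \<open>q\<close> is not covered by the kernel relation and is dropped.\<close>
  define c' where "c' b = c (s b) - c j * u (s b) / u j" for b
  have jp: "j \<le> p" using j by (simp add: q_def)
  have v': "v a = (\<Sum>b<p. U a (s b) * c' b)" if "a < q" for a
  proof -
    have "v a = v a - c j / u j * (\<Sum>b<q. U a b * u b)" using ker[OF that] by simp
    also have "\<dots> = (\<Sum>b<Suc p. U a b * (c b - c j * u b / u j))"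
      unfolding v_def q_def by (simp add: sum_subtractf sum_distrib_left algebra_simps)
    also have "\<dots> = (\<Sum>b<p. U a (s b) * c' b)"
      unfolding sum_lessThan_Suc_skip[OF jp] using j by (simp add: c'_def s_def)
    finally show ?thesis .
  qed
  have "tn_matrix (Suc p) p (\<lambda>a b. U a (s b))"
    by (rule tn_matrix_submatrix[OF TN]) (auto simp: q_def s_def strict_mono_on_def)
  moreover have "0 < (-1) ^ i * (\<Sum>b<p. U i (s b) * c' b)" if "i \<le> p" for i
    using alt[of i] v'[of i] that by (simp add: q_def)
  ultimately show False by (rule Suc.IH)
qed

text \<open>Columns are integrated one at a time. By linearity the new determinant is an integral of
  determinants with a point of \<open>J s\<close> in column \<open>s\<close>, and these are
  non-negative because the sets \<open>J b\<close> are ordered.\<close>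

lemma det_integrated_columns_nonneg:
  fixes f :: "real \<Rightarrow> real" and w :: "nat \<Rightarrow> real \<Rightarrow> real" and J :: "nat \<Rightarrow> real set"
  assumes tn: "totally_nonneg f" and x: "strict_mono_on {..<n} x"
    and J: "\<And>a b s t. a < b \<Longrightarrow> b < n \<Longrightarrow> s \<in> J a \<Longrightarrow> t \<in> J b \<Longrightarrow> s < t"
    and w: "\<And>b t. 0 \<le> w b t" "\<And>b t. t \<notin> J b \<Longrightarrow> w b t = 0"
    and int: "\<And>i b. i < n \<Longrightarrow> b < n \<Longrightarrow> integrable lborel (\<lambda>t. f (x i - t) * w b t)"
  shows "0 \<le> Determinant.det (Matrix.mat n n (\<lambda>(i, b). \<integral>t. f (x i - t) * w b t \<partial>lborel))"
proof -
  define I where "I i b = (\<integral>t. f (x i - t) * w b t \<partial>lborel)" for i b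
  have "0 \<le> Determinant.det (Matrix.mat n n (\<lambda>(i, b). if b < s then I i b else f (x i - t b)))"
    if "s \<le> n" "\<And>b. s \<le> b \<Longrightarrow> b < n \<Longrightarrow> t b \<in> J b" for s t
    using that
  proof (induction s arbitrary: t)
    case 0
    have "strict_mono_on {..<n} t"
      using 0 J by (auto simp: strict_mono_on_def)
    then show ?case using tn x unfolding totally_nonneg_def
      by (cases "n = 0") auto
  next
    case (Suc s)
    then have s: "s < n" by simp
    obtain \<kappa> where \<kappa>: "\<And>col. Determinant.det (Matrix.mat n n (\<lambda>(i, j). if j = s then col i
          else if j < s then I i j else f (x i - t j))) = (\<Sum>i<n. col i * \<kappa> i)"
      using det_column_linear[OF s, of "\<lambda>i j. if j < s then I i j else f (x i - t j)"] by blast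
    have pos: "0 \<le> (\<Sum>i<n. f (x i - y) * \<kappa> i)" if y: "y \<in> J s" for y
    proof -
      have "0 \<le> Determinant.det (Matrix.mat n n (\<lambda>(i, b). if b < s then I i b else f (x i - (t(s := y)) b)))"
        using Suc.prems y by (intro Suc.IH) (auto simp: Suc_le_eq)
      also have "Matrix.mat n n (\<lambda>(i, b). if b < s then I i b else f (x i - (t(s := y)) b)) =
          Matrix.mat n n (\<lambda>(i, j). if j = s then f (x i - y) else if j < s then I i j else f (x i - t j))"
        by (intro cong_mat) auto
      finally show ?thesis by (simp only: \<kappa>)
    qed
    have "Determinant.det (Matrix.mat n n (\<lambda>(i, b). if b < Suc s then I i b else f (x i - t b))) =
      Determinant.det (Matrix.mat n n (\<lambda>(i, j). if j = s then I i s else if j < s then I i j else f (x i - t j)))"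
      by (rule arg_cong[where f = Determinant.det], intro cong_mat) auto
    also have "\<dots> = (\<Sum>i<n. I i s * \<kappa> i)" by (rule \<kappa>)
    also have "\<dots> = (\<integral>y. (\<Sum>i<n. f (x i - y) * w s y * \<kappa> i) \<partial>lborel)"
      unfolding I_def using int s by simp
    also have "0 \<le> \<dots>"
    proof (rule integral_nonneg_AE, rule AE_I2)
      fix y
      have "(\<Sum>i<n. f (x i - y) * w s y * \<kappa> i) = w s y * (\<Sum>i<n. f (x i - y) * \<kappa> i)"
        by (simp add: sum_distrib_left algebra_simps)
      then show "0 \<le> (\<Sum>i<n. f (x i - y) * w s y * \<kappa> i)"
        using pos[of y] w(1)[of s y] w(2)[of y s] by (cases "y \<in> J s") auto
    qed
    finally show ?case .
  qed
  \<comment> \<open>With all columns integrated no point is left to choose, so \<open>x\<close> is a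
    mere placeholder for \<open>t\<close>.\<close>
  from this[of n x] have "0 \<le> Determinant.det (Matrix.mat n n (\<lambda>(i, b). if b < n then I i b else f (x i - x b)))"
    by auto
  also have "Matrix.mat n n (\<lambda>(i, b). if b < n then I i b else f (x i - x b)) = Matrix.mat n n (\<lambda>(i, b). I i b)"
    by (intro cong_mat) auto
  finally show ?thesis unfolding I_def .
qed

section \<open>Convolution with exponential sums on polynomials\<close>

text \<open>The formal operator c(D). Derivatives beyond \<open>degree w\<close> vanish, so every
  formal power series acts, in particular the inverse of a polynomial with non-zero constant
  term.\<close>

definition diff_op :: "real fps \<Rightarrow> real poly \<Rightarrow> real poly" where
  "diff_op c w = (\<Sum>k\<le>degree w. smult (fps_nth c k) ((pderiv ^^ k) w))"

lemma smult_sum_right: "smult a (sum f A) = (\<Sum>i\<in>A. smult a (f i))"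
  by (induction A rule: infinite_finite_induct) (simp_all add: smult_add_right)

lemma higher_pderiv_eq_0:
  fixes w :: "real poly"
  assumes "degree w < k"
  shows "(pderiv ^^ k) w = 0"
  using assms by (intro poly_eqI) (simp add: coeff_higher_pderiv coeff_eq_0)

lemma diff_op_upto:
  assumes "degree w \<le> K"
  shows "diff_op c w = (\<Sum>k\<le>K. smult (fps_nth c k) ((pderiv ^^ k) w))"
  unfolding diff_op_def using assms
  by (intro sum.mono_neutral_left) (auto simp: higher_pderiv_eq_0 not_le)

lemma degree_diff_op_le: "degree (diff_op c w) \<le> degree w"
  unfolding diff_op_def
  by (intro degree_sum_le order_trans[OF degree_smult_le]) (auto simp: degree_higher_pderiv)

text \<open>Products of series become compositions, so an inverse series gives the inverse operator.
  The square of index pairs shrinks to a triangle because \<open>k + j > K\<close> differentiates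
  \<open>w\<close> to zero.\<close>

lemma diff_op_mult: "diff_op (a * b) w = diff_op a (diff_op b w)"
proof -
  define K where "K = degree w"
  have "diff_op a (diff_op b w) = (\<Sum>k\<le>K. \<Sum>j\<le>K.
      smult (fps_nth a k * fps_nth b j) ((pderiv ^^ (k + j)) w))"
    by (subst diff_op_upto[OF order_trans[OF degree_diff_op_le order_refl]])
       (simp add: diff_op_def K_def higher_pderiv_sum higher_pderiv_smult smult_sum_right funpow_add o_def)
  also have "\<dots> = (\<Sum>(k, j)\<in>{..K} \<times> {..K}. smult (fps_nth a k * fps_nth b j) ((pderiv ^^ (k + j)) w))"
    by (simp add: sum.cartesian_product)
  also have "\<dots> = (\<Sum>(k, j)\<in>{(k, j). k + j \<le> K}. smult (fps_nth a k * fps_nth b j) ((pderiv ^^ (k + j)) w))"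
    by (intro sum.mono_neutral_right) (auto simp: K_def, meson higher_pderiv_eq_0 not_le)
  also have "\<dots> = (\<Sum>n\<le>K. \<Sum>i\<le>n. smult (fps_nth a i * fps_nth b (n - i)) ((pderiv ^^ (i + (n - i))) w))"
    by (rule sum.triangle_reindex_eq)
  also have "\<dots> = diff_op (a * b) w"
    by (simp add: diff_op_def K_def fps_mult_nth smult_sum atLeast0AtMost)
  finally show ?thesis by simp
qed

lemma diff_op_1 [simp]: "diff_op 1 w = w"
proof -
  have "diff_op 1 w = (\<Sum>k\<in>{0}. smult (fps_nth 1 k) ((pderiv ^^ k) w))"
    unfolding diff_op_def by (rule sum.mono_neutral_right) auto
  then show ?thesis by simp
qed

lemma diff_op_sum: "diff_op (sum a A) w = (\<Sum>l\<in>A. diff_op (a l) w)"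
  by (induction A rule: infinite_finite_induct)
     (simp_all add: diff_op_def smult_add_left sum.distrib)

lemma diff_op_const_mult: "diff_op (fps_const r * a) w = smult r (diff_op a w)"
  by (simp add: diff_op_def smult_sum_right)

lemma diff_op_linear: "diff_op (fps_of_poly [:r, 1:]) w = smult r w + pderiv w"
proof -
  have "diff_op (fps_of_poly [:r, 1:]) w = (\<Sum>k\<le>Suc (degree w). smult (coeff [:r, 1:] k) ((pderiv ^^ k) w))"
    by (subst diff_op_upto[of w "Suc (degree w)"]) simp_all
  also have "\<dots> = (\<Sum>k\<in>{0, 1}. smult (coeff [:r, 1:] k) ((pderiv ^^ k) w))"
    by (rule sum.mono_neutral_right) (auto simp: coeff_pCons split: nat.splits)
  finally show ?thesis by simp
qed

section \<open>Integrals of polynomials against exponentials\<close>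

text \<open>Up to a constant factor the integrand is an Erlang density, of total mass 1.\<close>

lemma integrable_power_exp:
  assumes "0 < \<gamma>"
  shows "integrable lborel (\<lambda>t::real. indicator {0..} t * (exp (- \<gamma> * t) * t ^ k))"
proof -
  interpret prob_space "density lborel (erlang_density k \<gamma>)"
    by (rule prob_space_erlang_density[OF assms])
  have "(\<integral>\<^sup>+ t. ennreal (erlang_density k \<gamma> t) \<partial>lborel) = 1"
    using emeasure_space_1 by (simp add: emeasure_density)
  then have "integrable lborel (erlang_density k \<gamma>)"
    by (intro integrableI_nonneg) (use assms in \<open>auto intro!: AE_I2 erlang_density_nonneg\<close>)
  then have "integrable lborel (\<lambda>t. fact k / \<gamma> ^ Suc k * erlang_density k \<gamma> t)"
    by (rule integrable_mult_right)
  then show ?thesis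
    by (rule Bochner_Integration.integrable_cong[THEN iffD1, rotated 2])
       (use assms in \<open>auto simp: erlang_density_def split: split_indicator\<close>)
qed

lemma integrable_poly_exp:
  assumes "0 < \<gamma>"
  shows "integrable lborel (\<lambda>t::real. indicator {0..} t * (exp (- \<gamma> * t) * poly q (x - t)))"
proof -
  define p where "p = pcompose q [:x, -1:]"
  have "integrable lborel (\<lambda>t. \<Sum>k\<le>degree p. coeff p k * (indicator {0..} t * (exp (- \<gamma> * t) * t ^ k)))"
    by (intro Bochner_Integration.integrable_sum integrable_mult_right integrable_power_exp assms)
  moreover have "(\<Sum>k\<le>degree p. coeff p k * (indicator {0..} t * (exp (- \<gamma> * t) * t ^ k))) =
      indicator {0..} t * (exp (- \<gamma> * t) * poly q (x - t))" for t
  proof -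
    have "poly q (x - t) = poly p t" by (simp add: p_def poly_pcompose)
    then show ?thesis by (simp add: poly_altdef sum_distrib_left algebra_simps)
  qed
  ultimately show ?thesis by simp
qed

lemma tendsto_poly_exp_0:
  assumes "0 < \<gamma>"
  shows "((\<lambda>t::real. exp (- \<gamma> * t) * poly q (x - t)) \<longlongrightarrow> 0) at_top"
proof -
  define p where "p = pcompose q [:x, -1:]"
  have *: "((\<lambda>t. exp (- \<gamma> * t) * t ^ k) \<longlongrightarrow> 0) at_top" for k
  proof -
    have "filterlim (\<lambda>t. \<gamma> * t) at_top at_top"
      using assms by (rule filterlim_tendsto_pos_mult_at_top[OF tendsto_const _ filterlim_ident])
    then have "((\<lambda>t. (\<gamma> * t) ^ k / exp (\<gamma> * t)) \<longlongrightarrow> 0) at_top"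
      by (rule filterlim_compose[OF tendsto_power_div_exp_0])
    then have "((\<lambda>t. (\<gamma> * t) ^ k / exp (\<gamma> * t) * (1 / \<gamma> ^ k)) \<longlongrightarrow> 0 * (1 / \<gamma> ^ k)) at_top"
      by (intro tendsto_intros)
    then show ?thesis using assms by (simp add: power_mult_distrib exp_minus field_simps)
  qed
  have "((\<lambda>t. \<Sum>k\<le>degree p. coeff p k * (exp (- \<gamma> * t) * t ^ k)) \<longlongrightarrow> (\<Sum>k\<le>degree p. coeff p k * 0)) at_top"
    by (intro tendsto_intros *)
  moreover have "(\<Sum>k\<le>degree p. coeff p k * (exp (- \<gamma> * t) * t ^ k)) = exp (- \<gamma> * t) * poly q (x - t)" for t
  proof -
    have "poly q (x - t) = poly p t" by (simp add: p_def poly_pcompose)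
    then show ?thesis by (simp add: poly_altdef sum_distrib_left algebra_simps)
  qed
  ultimately show ?thesis by simp
qed

text \<open>Convolution with the exponential inverts \<gamma> + D on polynomials: the integrand is
  the derivative of \<open>G\<close>, which tends to 0 at infinity, and \<open>- G 0\<close> is
  \<open>poly u x\<close>.\<close>

lemma integral_exp_poly:
  fixes \<gamma> x :: real
  assumes "0 < \<gamma>"
  shows "(\<integral>t. indicator {0..} t * (exp (- \<gamma> * t) * poly (smult \<gamma> u + pderiv u) (x - t)) \<partial>lborel) = poly u x"
proof -
  define q where "q = smult \<gamma> u + pderiv u"
  define G where "G t = - (exp (- \<gamma> * t) * poly u (x - t))" for t
  have G: "(G has_field_derivative exp (- \<gamma> * t) * poly q (x - t)) (at t within S)" for t S
    unfolding G_def q_def by (auto intro!: derivative_eq_intros simp: algebra_simps)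
  have fin: "(\<integral>t. indicator {..y} t *\<^sub>R (indicator {0..} t * (exp (- \<gamma> * t) * poly q (x - t))) \<partial>lborel) = G y - G 0"
    if "0 \<le> y" for y
  proof -
    have "has_bochner_integral lborel (\<lambda>t. indicator {0..y} t *\<^sub>R (exp (- \<gamma> * t) * poly q (x - t))) (G y - G 0)"
      using that G
      by (intro has_bochner_integral_FTC_Icc continuous_intros) (auto simp flip: has_real_derivative_iff_has_vector_derivative)
    then have "(\<integral>t. indicator {0..y} t *\<^sub>R (exp (- \<gamma> * t) * poly q (x - t)) \<partial>lborel) = G y - G 0"
      by (rule has_bochner_integral_integral_eq)
    moreover have "indicator {0..y} t *\<^sub>R (exp (- \<gamma> * t) * poly q (x - t)) =
        indicator {..y} t *\<^sub>R (indicator {0..} t * (exp (- \<gamma> * t) * poly q (x - t)))" for t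
      by (auto split: split_indicator)
    ultimately show ?thesis by (simp only:)
  qed
  have "((\<lambda>y. \<integral>t. indicator {..y} t *\<^sub>R (indicator {0..} t * (exp (- \<gamma> * t) * poly q (x - t))) \<partial>lborel)
      \<longlongrightarrow> (\<integral>t. indicator {0..} t * (exp (- \<gamma> * t) * poly q (x - t)) \<partial>lborel)) at_top"
    by (intro tendsto_integral_at_top integrable_poly_exp assms) simp
  moreover have "((\<lambda>y. G y - G 0) \<longlongrightarrow> - 0 - G 0) at_top"
    unfolding G_def by (intro tendsto_intros tendsto_poly_exp_0 assms)
  then have "((\<lambda>y. \<integral>t. indicator {..y} t *\<^sub>R (indicator {0..} t * (exp (- \<gamma> * t) * poly q (x - t))) \<partial>lborel)
      \<longlongrightarrow> - 0 - G 0) at_top"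
    by (rule Lim_transform_eventually)
       (use eventually_ge_at_top[of "0::real"] in eventually_elim, rule fin[symmetric])
  ultimately have "(\<integral>t. indicator {0..} t * (exp (- \<gamma> * t) * poly q (x - t)) \<partial>lborel) = - 0 - G 0"
    by (rule tendsto_unique[OF trivial_limit_at_top_linorder])
  then show ?thesis by (simp add: q_def G_def)
qed

lemma poly_same_sign_between:
  fixes p :: "real poly"
  assumes "s < t" "\<And>z. s \<le> z \<Longrightarrow> z \<le> t \<Longrightarrow> poly p z \<noteq> 0"
  shows "sgn (poly p s) = sgn (poly p t)"
proof (rule ccontr)
  assume "\<not> ?thesis"
  moreover have "poly p s \<noteq> 0" "poly p t \<noteq> 0" using assms by auto
  ultimately have "poly p s < 0 \<and> 0 < poly p t \<or> 0 < poly p s \<and> poly p t < 0"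
    by (auto simp: sgn_if split: if_splits)
  then obtain z where "s < z" "z < t" "poly p z = 0"
    using poly_IVT_pos[OF assms(1)] poly_IVT_neg[OF assms(1)] by blast
  then show False using assms by force
qed

text \<open>The columns fed to the matrix lemma are the integrals over the intervals between consecutive
  roots of \<open>g\<close>, where \<open>g\<close> has constant sign.\<close>

lemma totally_nonneg_alternation_roots:
  fixes g :: "real poly"
  assumes tn: "totally_nonneg f" and g: "g \<noteq> 0"
    and int: "\<And>x. integrable lborel (\<lambda>t. f (x - t) * poly g t)"
    and x: "strict_mono_on {..n} x"
    and alt: "\<And>i. i \<le> n \<Longrightarrow> 0 < \<epsilon> * (-1) ^ i * (\<integral>t. f (x i - t) * poly g t \<partial>lborel)"
  shows "n \<le> card {z. poly g z = 0}"
proof (rule ccontr)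
  define Z where "Z = {z. poly g z = 0}"
  define q where "q = Suc (card Z)"
  assume "\<not> n \<le> card {z. poly g z = 0}"
  then have qn: "q \<le> n" by (simp add: q_def Z_def)
  have finZ: "finite Z" unfolding Z_def using g by (rule poly_roots_finite)
  define cnt where "cnt t = card {z\<in>Z. z < t}" for t
  have cnt_le: "cnt t < q" for t
    unfolding cnt_def q_def using finZ by (simp add: card_mono less_Suc_eq_le)
  have cnt_mono: "cnt s \<le> cnt t" if "s \<le> t" for s t
    unfolding cnt_def using that finZ by (intro card_mono) auto
  have cnt_between: "poly g z \<noteq> 0" if "cnt s = cnt t" "s \<le> z" "z < t" for s t z
  proof
    assume "poly g z = 0"
    then have "z \<in> {z\<in>Z. z < t}" "z \<notin> {z\<in>Z. z < s}" using that by (simp_all add: Z_def)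
    moreover have "{z\<in>Z. z < s} \<subseteq> {z\<in>Z. z < t}" using that by auto
    ultimately have "{z\<in>Z. z < s} \<subset> {z\<in>Z. z < t}" by blast
    then have "cnt s < cnt t" unfolding cnt_def using finZ by (intro psubset_card_mono) auto
    then show False using that by simp
  qed
  \<comment> \<open>One of the \<open>q\<close> gaps left by the roots, indexed by the number of
    roots to its left. The roots belong to no gap, but \<open>g\<close> vanishes there.\<close>
  define J where "J b = {t. t \<notin> Z \<and> cnt t = b}" for b
  have cnt_sum: "(\<lambda>t. real (cnt t)) = (\<lambda>t. \<Sum>z\<in>Z. indicator {z<..} t)"
  proof
    fix t
    have "(\<Sum>z\<in>Z. indicator {z<..} t) = (\<Sum>z\<in>Z. if z < t then 1 else (0::real))"
      by (intro sum.cong) (simp_all add: indicator_def)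
    also have "\<dots> = real (cnt t)"
      unfolding cnt_def by (simp only: sum.inter_filter[OF finZ, symmetric] card_eq_sum of_nat_sum of_nat_1)
    finally show "real (cnt t) = (\<Sum>z\<in>Z. indicator {z<..} t)" by (rule sym)
  qed
  have cnt_meas: "(\<lambda>t. real (cnt t)) \<in> borel_measurable borel"
    unfolding cnt_sum by (intro borel_measurable_sum borel_measurable_indicator) simp
  have Z_meas: "Z \<in> sets borel" using finZ by (intro borel_closed finite_imp_closed)
  have J_eq: "J b = ((\<lambda>t. real (cnt t)) -` {real b} \<inter> space borel) - Z" for b
    unfolding J_def by fastforce
  have J_meas [measurable]: "J b \<in> sets borel" for b
    unfolding J_eq by (rule sets.Diff[OF measurable_sets[OF cnt_meas] Z_meas]) simp
  define w where "w b t = indicator (J b) t * \<bar>poly g t\<bar>" for b t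
  \<comment> \<open>The sign of \<open>g\<close> is constant on a gap, so any point will do. For an
    empty \<open>J b\<close> the value is arbitrary, which is harmless because \<open>w b\<close> is
    then zero.\<close>
  define \<sigma> where "\<sigma> b = sgn (poly g (SOME t. t \<in> J b))" for b
  have \<sigma>: "\<sigma> b = sgn (poly g t)" if t: "t \<in> J b" for b t
  proof -
    define t' where "t' = (SOME t. t \<in> J b)"
    have t': "t' \<in> J b" unfolding t'_def using t by (rule someI)
    have same: "sgn (poly g s) = sgn (poly g s')" if "s < s'" "s \<in> J b" "s' \<in> J b" for s s'
    proof (rule poly_same_sign_between[OF that(1)])
      fix z assume "s \<le> z" "z \<le> s'"
      then show "poly g z \<noteq> 0"
        using that cnt_between[of s s' z] by (cases "z = s'") (simp_all add: J_def Z_def)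
    qed
    show ?thesis unfolding \<sigma>_def t'_def[symmetric]
      using same[OF _ t t'] same[OF _ t' t] by (metis linorder_neqE)
  qed
  have w_int: "integrable lborel (\<lambda>t. f (y - t) * w b t)" for y b
  proof -
    have "integrable lborel (\<lambda>t. indicator (J b) t *\<^sub>R (\<sigma> b * (f (y - t) * poly g t)))"
      by (intro integrable_mult_indicator integrable_mult_right int) simp
    moreover have "(\<lambda>t. indicator (J b) t *\<^sub>R (\<sigma> b * (f (y - t) * poly g t))) = (\<lambda>t. f (y - t) * w b t)"
      using \<sigma>[of _ b] by (intro ext) (auto simp: w_def abs_sgn split: split_indicator)
    ultimately show ?thesis by (simp only:)
  qed
  define U where "U i b = (\<integral>t. f (x i - t) * w b t \<partial>lborel)" for i b
  have "tn_matrix (Suc q) q U"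
    unfolding tn_matrix_def
  proof (intro allI impI)
    fix k and \<rho> \<gamma> :: "nat \<Rightarrow> nat"
    assume \<rho>: "strict_mono_on {..<k} \<rho>" "\<rho> ` {..<k} \<subseteq> {..<Suc q}"
      and \<gamma>: "strict_mono_on {..<k} \<gamma>" "\<gamma> ` {..<k} \<subseteq> {..<q}"
    have x_\<rho>: "strict_mono_on {..<k} (\<lambda>i. x (\<rho> i))"
    proof (rule strict_mono_onI)
      fix r s assume rs: "r \<in> {..<k}" "s \<in> {..<k}" "r < s"
      then have "\<rho> r < \<rho> s" using \<rho>(1) by (simp add: strict_mono_onD)
      moreover have "\<rho> i \<in> {..n}" if "i \<in> {..<k}" for i
      proof -
        have "\<rho> i \<in> {..<Suc q}" using \<rho>(2) that by blast
        then show ?thesis using qn by simp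
      qed
      ultimately show "x (\<rho> r) < x (\<rho> s)" using rs x by (simp add: strict_mono_onD)
    qed
    have ordered: "s < t" if "a < b" "b < k" "s \<in> J (\<gamma> a)" "t \<in> J (\<gamma> b)" for a b s t
    proof (rule ccontr)
      assume "\<not> s < t"
      then have "cnt t \<le> cnt s" by (intro cnt_mono) simp
      moreover have "\<gamma> a < \<gamma> b" using \<gamma>(1) that by (simp add: strict_mono_onD)
      ultimately show False using that by (simp add: J_def)
    qed
    show "0 \<le> Determinant.det (Matrix.mat k k (\<lambda>(i, j). U (\<rho> i) (\<gamma> j)))"
      unfolding U_def
    proof (rule det_integrated_columns_nonneg[OF tn x_\<rho>, where J = "\<lambda>b. J (\<gamma> b)"])
      show "0 \<le> w (\<gamma> b) t" for b t by (simp add: w_def)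
      show "w (\<gamma> b) t = 0" if "t \<notin> J (\<gamma> b)" for b t using that by (simp add: w_def)
    qed (use ordered w_int in blast)+
  qed
  \<comment> \<open>As \<open>g\<close> is the sum of the \<open>\<sigma> b * w b\<close>, its
    integrals are combinations of only \<open>q\<close> columns, which cannot alternate over
    \<open>q + 1\<close> rows.\<close>
  moreover have "0 < (-1) ^ i * (\<Sum>b<q. U i b * (\<epsilon> * \<sigma> b))" if "i \<le> q" for i
  proof -
    have "(\<Sum>b<q. \<sigma> b * (f (x i - t) * w b t)) = f (x i - t) * poly g t" for t
    proof (cases "t \<in> Z")
      case True
      then show ?thesis by (simp add: w_def Z_def)
    next
      case False
      then have t: "t \<in> J (cnt t)" by (simp add: J_def)
      have "(\<Sum>b<q. \<sigma> b * (f (x i - t) * w b t)) = (\<Sum>b\<in>{cnt t}. \<sigma> b * (f (x i - t) * w b t))"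
        using cnt_le[of t] by (intro sum.mono_neutral_right) (auto simp: w_def J_def)
      then show ?thesis using t \<sigma>[OF t] by (simp add: w_def mult_sgn_abs)
    qed
    then have "(\<integral>t. f (x i - t) * poly g t \<partial>lborel) = (\<integral>t. (\<Sum>b<q. \<sigma> b * (f (x i - t) * w b t)) \<partial>lborel)"
      by simp
    also have "\<dots> = (\<Sum>b<q. U i b * \<sigma> b)"
      unfolding U_def using w_int by (simp add: mult.commute)
    finally show ?thesis
      using alt[of i] that qn by (simp add: sum_distrib_left algebra_simps)
  qed
  ultimately show False by (rule tn_matrix_no_alternation)
qed

section \<open>Real-rootedness and entire power series\<close>

text \<open>Newton's identity for the second power sum: coefficients 1 and 2 of the product are, up
  to sign, the first two elementary symmetric functions of \<open>Z\<close>.\<close>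

lemma sum_squares_coeff_prod_linear:
  fixes Z :: "real set"
  assumes "finite Z"
  defines "q \<equiv> \<Prod>z\<in>Z. [:1, - z:]"
  shows "coeff q 0 = 1" "(coeff q (Suc 0))\<^sup>2 - 2 * coeff q (Suc (Suc 0)) = (\<Sum>z\<in>Z. z\<^sup>2)"
proof -
  have "coeff (\<Prod>z\<in>Z. [:1, - z:]) 0 = 1 \<and>
    (coeff (\<Prod>z\<in>Z. [:1, - z:]) (Suc 0))\<^sup>2 - 2 * coeff (\<Prod>z\<in>Z. [:1, - z:]) (Suc (Suc 0)) = (\<Sum>z\<in>Z. z\<^sup>2)"
    using assms(1) by induction (auto simp: power2_eq_square algebra_simps)
  then show "coeff q 0 = 1" "(coeff q (Suc 0))\<^sup>2 - 2 * coeff q (Suc (Suc 0)) = (\<Sum>z\<in>Z. z\<^sup>2)"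
    by (simp_all add: q_def)
qed

text \<open>By Newton's identity, applied to the reversed polynomial, \<open>B\<close> is the mean
  of the squared roots. The square of \<open>coeff g 0 / a\<close> is their product, so this is the
  arithmetic-geometric mean inequality.\<close>

lemma real_rooted_coeff_bound:
  fixes g :: "real poly"
  assumes n: "2 \<le> n" and deg: "degree g = n" and roots: "card {z. poly g z = 0} = n"
  defines "a \<equiv> coeff g n"
  defines "B \<equiv> ((coeff g (n - 1) / a)\<^sup>2 - 2 * (coeff g (n - 2) / a)) / n"
  shows "0 \<le> B" "(coeff g 0 / a)\<^sup>2 \<le> B ^ n"
proof -
  define Z where "Z = {z. poly g z = 0}"
  have g0: "g \<noteq> 0" using deg n by auto
  have a: "a \<noteq> 0" using g0 deg by (auto simp: a_def)
  have Z: "finite Z" "card Z = n" using poly_roots_finite[OF g0] roots by (simp_all add: Z_def)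
  then have Z_ne: "Z \<noteq> {}" using n by auto
  define P where "P = (\<Prod>z\<in>Z. [:- z, 1:])"
  have degP: "degree P = n" unfolding P_def using Z by (subst degree_prod_sum_eq) auto
  have "lead_coeff P = 1" unfolding P_def by (simp add: lead_coeff_prod)
  then have leadP: "coeff P n = 1" using degP by simp
  have gP: "g = smult a P"
  proof (rule poly_eqI_degree_lead_coeff[of _ n _ Z])
    fix z assume "z \<in> Z"
    then show "poly g z = poly (smult a P) z"
      using Z by (auto simp: Z_def P_def poly_prod prod_zero_iff)
  qed (use deg degP leadP Z a in \<open>auto simp: a_def\<close>)
  have "reflect_poly P = (\<Prod>z\<in>Z. [:1, - z:])"
    unfolding P_def reflect_poly_prod by (intro prod.cong) (auto simp: reflect_poly_def)
  then have coeffs: "coeff (\<Prod>z\<in>Z. [:1, - z:]) (Suc 0) = coeff P (n - 1)"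
      "coeff (\<Prod>z\<in>Z. [:1, - z:]) (Suc (Suc 0)) = coeff P (n - 2)"
    using n degP coeff_reflect_poly[of P "Suc 0"] coeff_reflect_poly[of P "Suc (Suc 0)"]
    by (simp_all add: numeral_2_eq_2)
  have B: "B = (\<Sum>z\<in>Z. z\<^sup>2) / n"
    using sum_squares_coeff_prod_linear(2)[OF Z(1)] a unfolding coeffs B_def gP by simp
  show "0 \<le> B" unfolding B by (simp add: sum_nonneg)
  define Q where "Q = (\<Prod>z\<in>Z. z\<^sup>2)"
  have Q0: "0 \<le> Q" unfolding Q_def by (intro prod_nonneg) simp
  have "coeff P 0 = (\<Prod>z\<in>Z. - z)" by (simp add: P_def poly_prod flip: poly_0_coeff_0)
  then have "(coeff P 0)\<^sup>2 = Q" by (simp add: Q_def prod_power_distrib)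
  then have "(coeff g 0 / a)\<^sup>2 = Q" using a by (simp add: gP)
  also have "Q = (Q powr (1 / n)) ^ n"
    using Q0 n by (cases "Q = 0") (auto simp: powr_powr simp flip: powr_realpow)
  also have "\<dots> \<le> (\<Sum>z\<in>Z. z\<^sup>2 / n) ^ n"
    using arith_geom_mean[OF Z(1) Z_ne, of "\<lambda>z. z\<^sup>2"] Z(2) by (intro power_mono) (auto simp: Q_def)
  also have "\<dots> = B ^ n" unfolding B by (simp add: sum_divide_distrib)
  finally show "(coeff g 0 / a)\<^sup>2 \<le> B ^ n" .
qed

text \<open>A stand-in for X^n with simple roots: strict sign alternation can be read off between
  them, which X^n itself does not offer.\<close>

definition equispaced_poly :: "nat \<Rightarrow> real \<Rightarrow> real poly" where
  "equispaced_poly n \<epsilon> = (\<Prod>i<n. [:- (\<epsilon> * real i), 1:])"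

lemma degree_equispaced_poly: "degree (equispaced_poly n \<epsilon>) = n"
  unfolding equispaced_poly_def by (subst degree_prod_sum_eq) auto

lemma lead_coeff_equispaced_poly: "coeff (equispaced_poly n \<epsilon>) n = 1"
proof -
  have "lead_coeff (equispaced_poly n \<epsilon>) = 1"
    unfolding equispaced_poly_def by (simp add: lead_coeff_prod)
  then show ?thesis by (simp add: degree_equispaced_poly)
qed

lemma tendsto_coeff_equispaced_poly:
  "((\<lambda>\<epsilon>. coeff (equispaced_poly n \<epsilon>) k) \<longlongrightarrow> (if k = n then 1 else 0)) (at_right 0)"
proof (induction n arbitrary: k)
  case 0
  show ?case by (simp add: equispaced_poly_def)
next
  case (Suc n)
  have eq: "coeff (equispaced_poly (Suc n) \<epsilon>) k =
      - (\<epsilon> * real n) * coeff (equispaced_poly n \<epsilon>) k + (case k of 0 \<Rightarrow> 0 | Suc j \<Rightarrow> coeff (equispaced_poly n \<epsilon>) j)" for \<epsilon>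
    by (simp add: equispaced_poly_def mult.commute[of _ "[:_, _:]"] coeff_pCons split: nat.split)
  have "((\<lambda>\<epsilon>. case k of 0 \<Rightarrow> 0 | Suc j \<Rightarrow> coeff (equispaced_poly n \<epsilon>) j)
    \<longlongrightarrow> (case k of 0 \<Rightarrow> 0 | Suc j \<Rightarrow> if j = n then 1 else 0)) (at_right 0)"
    by (cases k) (simp, simp only: nat.case, rule Suc.IH)
  then have "((\<lambda>\<epsilon>. - (\<epsilon> * real n) * coeff (equispaced_poly n \<epsilon>) k +
      (case k of 0 \<Rightarrow> 0 | Suc j \<Rightarrow> coeff (equispaced_poly n \<epsilon>) j))
    \<longlongrightarrow> - (0 * real n) * (if k = n then 1 else 0) + (case k of 0 \<Rightarrow> 0 | Suc j \<Rightarrow> if j = n then 1 else 0)) (at_right 0)"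
    by (intro tendsto_add tendsto_mult tendsto_minus tendsto_const tendsto_ident_at Suc.IH)
  then show ?case unfolding eq by (cases k) auto
qed

lemma coeff_diff_op:
  "coeff (diff_op c w) j = (\<Sum>k\<le>degree w. fps_nth c k * (pochhammer (real (Suc j)) k * coeff w (j + k)))"
  by (simp add: diff_op_def coeff_sum coeff_higher_pderiv)

lemma coeff_diff_op_equispaced_lead: "coeff (diff_op c (equispaced_poly n \<epsilon>)) n = fps_nth c 0"
proof -
  have "coeff (diff_op c (equispaced_poly n \<epsilon>)) n =
      (\<Sum>k\<in>{0}. fps_nth c k * (pochhammer (real (Suc n)) k * coeff (equispaced_poly n \<epsilon>) (n + k)))"
    unfolding coeff_diff_op degree_equispaced_poly
    by (rule sum.mono_neutral_right) (auto simp: coeff_eq_0 degree_equispaced_poly)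
  then show ?thesis by (simp add: lead_coeff_equispaced_poly)
qed

text \<open>The limit is the coefficient of c(D) X^n, since all roots collapse to 0; the Pochhammer
  factor is n! / j!.\<close>

lemma tendsto_coeff_diff_op_equispaced:
  assumes "j \<le> n"
  shows "((\<lambda>\<epsilon>. coeff (diff_op c (equispaced_poly n \<epsilon>)) j) \<longlongrightarrow>
    fps_nth c (n - j) * pochhammer (real (Suc j)) (n - j)) (at_right 0)"
proof -
  have "((\<lambda>\<epsilon>. coeff (diff_op c (equispaced_poly n \<epsilon>)) j) \<longlongrightarrow>
      (\<Sum>k\<le>n. fps_nth c k * (pochhammer (real (Suc j)) k * (if j + k = n then 1 else 0)))) (at_right 0)"
    unfolding coeff_diff_op degree_equispaced_poly
    by (intro tendsto_sum tendsto_mult tendsto_const tendsto_coeff_equispaced_poly)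
  also have "(\<Sum>k\<le>n. fps_nth c k * (pochhammer (real (Suc j)) k * (if j + k = n then 1 else 0))) =
      (\<Sum>k\<in>{n - j}. fps_nth c k * (pochhammer (real (Suc j)) k * (if j + k = n then 1 else 0)))"
    using assms by (intro sum.mono_neutral_right) auto
  finally show ?thesis using assms by simp
qed

text \<open>Letting the roots \<open>0, \<epsilon>, \<dots>, (n - 1) \<epsilon>\<close> collapse bounds the \<open>n\<close>-th coefficient by the product of
  the roots of a real-rooted polynomial, whose sum of squares only involves the first three
  coefficients.\<close>

lemma fps_coeff_bound_of_real_rooted:
  assumes c0: "fps_nth c 0 \<noteq> 0" and n: "2 \<le> n"
    and roots: "\<And>\<epsilon>. 0 < \<epsilon> \<Longrightarrow> n \<le> card {z. poly (diff_op c (equispaced_poly n \<epsilon>)) z = 0}"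
  defines "M \<equiv> (fps_nth c 1 / fps_nth c 0)\<^sup>2 + 2 * \<bar>fps_nth c 2 / fps_nth c 0\<bar>"
  shows "(fact n * fps_nth c n / fps_nth c 0)\<^sup>2 \<le> (real n * M) ^ n"
proof -
  define g where "g \<epsilon> = diff_op c (equispaced_poly n \<epsilon>)" for \<epsilon>
  define a where "a = fps_nth c 0"
  define B where "B \<epsilon> = ((coeff (g \<epsilon>) (n - 1) / a)\<^sup>2 - 2 * (coeff (g \<epsilon>) (n - 2) / a)) / n" for \<epsilon>
  have lead: "coeff (g \<epsilon>) n = a" for \<epsilon>
    by (simp add: g_def a_def coeff_diff_op_equispaced_lead)
  have deg: "degree (g \<epsilon>) = n" for \<epsilon>
  proof (rule antisym)
    show "degree (g \<epsilon>) \<le> n" unfolding g_def using degree_diff_op_le[of c "equispaced_poly n \<epsilon>"]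
      by (simp add: degree_equispaced_poly)
    show "n \<le> degree (g \<epsilon>)" using lead[of \<epsilon>] c0 by (intro le_degree) (simp add: a_def)
  qed
  have card: "card {z. poly (g \<epsilon>) z = 0} = n" if "0 < \<epsilon>" for \<epsilon>
  proof (rule antisym)
    have "g \<epsilon> \<noteq> 0" using deg[of \<epsilon>] n by auto
    then show "card {z. poly (g \<epsilon>) z = 0} \<le> n" using card_poly_roots_bound deg[of \<epsilon>] by metis
    show "n \<le> card {z. poly (g \<epsilon>) z = 0}" unfolding g_def by (rule roots[OF that])
  qed
  have bound: "0 \<le> B \<epsilon>" "(coeff (g \<epsilon>) 0 / a)\<^sup>2 \<le> B \<epsilon> ^ n" if "0 < \<epsilon>" for \<epsilon>
    using real_rooted_coeff_bound[OF n deg card[OF that]] by (simp_all add: B_def lead)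
  define L where "L = ((fps_nth c 1 * n / a)\<^sup>2 - 2 * (fps_nth c 2 * ((n - 1) * n) / a)) / n"
  have lim0: "((\<lambda>\<epsilon>. coeff (g \<epsilon>) 0) \<longlongrightarrow> fact n * fps_nth c n) (at_right 0)"
    using tendsto_coeff_diff_op_equispaced[of 0 n c]
    by (simp add: g_def pochhammer_fact[symmetric] mult.commute)
  have lim1: "((\<lambda>\<epsilon>. coeff (g \<epsilon>) (n - 1)) \<longlongrightarrow> fps_nth c 1 * n) (at_right 0)"
    using tendsto_coeff_diff_op_equispaced[of "n - 1" n c] n by (simp add: g_def)
  have "pochhammer (real (Suc (n - 2))) 2 = (n - 1) * n"
    using n by (simp add: numeral_2_eq_2 pochhammer_Suc Suc_diff_Suc of_nat_diff)
  then have lim2: "((\<lambda>\<epsilon>. coeff (g \<epsilon>) (n - 2)) \<longlongrightarrow> fps_nth c 2 * ((n - 1) * n)) (at_right 0)"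
    using tendsto_coeff_diff_op_equispaced[of "n - 2" n c] n by (simp add: g_def)
  have limB: "(B \<longlongrightarrow> L) (at_right 0)"
    unfolding B_def L_def using n c0 by (intro tendsto_intros lim1 lim2) (auto simp: a_def)
  have pos: "\<forall>\<^sub>F \<epsilon> in at_right 0. (0::real) < \<epsilon>" by (rule eventually_at_right_less)
  have L0: "0 \<le> L"
    by (rule tendsto_lowerbound[OF limB]) (use pos bound(1) in \<open>auto elim: eventually_mono\<close>)
  have "(fact n * fps_nth c n / a)\<^sup>2 \<le> L ^ n"
  proof (rule tendsto_le[OF _ tendsto_power[OF limB]])
    show "((\<lambda>\<epsilon>. (coeff (g \<epsilon>) 0 / a)\<^sup>2) \<longlongrightarrow> (fact n * fps_nth c n / a)\<^sup>2) (at_right 0)"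
      using c0 by (intro tendsto_intros lim0) (auto simp: a_def)
    show "\<forall>\<^sub>F \<epsilon> in at_right 0. (coeff (g \<epsilon>) 0 / a)\<^sup>2 \<le> B \<epsilon> ^ n"
      using pos by eventually_elim (rule bound(2))
  qed simp
  \<comment> \<open>\<open>L\<close> grows only linearly, because the mean divides the quadratic
    factors by \<open>n\<close>. The sign of \<open>fps_nth c 2 / a\<close> is unknown, hence the
    absolute value in \<open>M\<close>.\<close>
  also have "L ^ n \<le> (real n * M) ^ n"
  proof (rule power_mono[OF _ L0])
    have L_eq: "L = real n * (fps_nth c 1 / a)\<^sup>2 - real (n - 1) * (2 * (fps_nth c 2 / a))"
      unfolding L_def using n by (simp add: field_simps power2_eq_square)
    have "real (n - 1) * - y \<le> real (n - 1) * \<bar>y\<bar>" for y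
      by (intro mult_left_mono abs_ge_minus_self) simp
    from this[of "fps_nth c 2 / a"]
    have "L \<le> real n * (fps_nth c 1 / a)\<^sup>2 + real (n - 1) * (2 * \<bar>fps_nth c 2 / a\<bar>)"
      unfolding L_eq by linarith
    also have "\<dots> \<le> real n * (fps_nth c 1 / a)\<^sup>2 + real n * (2 * \<bar>fps_nth c 2 / a\<bar>)"
      by (intro add_left_mono mult_right_mono) auto
    also have "\<dots> = real n * M" by (simp add: M_def a_def algebra_simps)
    finally show "L \<le> real n * M" .
  qed
  finally show ?thesis by (simp add: a_def)
qed

section \<open>From coefficient bounds to entire series and common roots\<close>

text \<open>A crude Stirling bound: the quotient of \<open>n ^ n\<close> by the factorial is one
  term of the series of \<open>exp n\<close>.\<close>

lemma power_self_le_exp_fact: "real n ^ n \<le> exp 1 ^ n * fact n"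
proof -
  have "real n ^ n / fact n = (\<Sum>k\<in>{n}. real n ^ k /\<^sub>R fact k)"
    by (simp add: divide_inverse_commute)
  also have "\<dots> \<le> exp (real n)"
    unfolding exp_def by (intro sum_le_suminf summable_exp_generic) simp_all
  also have "\<dots> = exp 1 ^ n" using exp_of_nat_mult[of n "1::real"] by simp
  finally show ?thesis by (simp add: field_simps)
qed

text \<open>The bound on n! c_n is of order (M n)^(n/2), while n! is at least (n/e)^n, so c_n decays
  faster than any geometric sequence.\<close>

lemma summable_of_coeff_bound:
  fixes c :: "nat \<Rightarrow> real" and z :: complex
  assumes bound: "\<And>n. 2 \<le> n \<Longrightarrow> (fact n * c n)\<^sup>2 \<le> K\<^sup>2 * (real n * M) ^ n" and M: "0 \<le> M"
  shows "summable (\<lambda>n. complex_of_real (c n) * z ^ n)"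
proof (rule summable_comparison_test_ev)
  \<comment> \<open>From \<open>T\<close> on, the square of the n-th term is at most K^2 /
    4^n.\<close>
  define T where "T = 4 * M * (norm z)\<^sup>2 * (exp 1)\<^sup>2"
  have "\<forall>\<^sub>F n in sequentially. T \<le> real n"
    using filterlim_real_sequentially by (simp add: filterlim_at_top)
  then show "\<forall>\<^sub>F n in sequentially. norm (complex_of_real (c n) * z ^ n) \<le> \<bar>K\<bar> * (1 / 2) ^ n"
    using eventually_ge_at_top[of 2]
  proof eventually_elim
    case (elim n)
    define r where "r = norm z"
    have n: "0 < real n" using elim by simp
    have "(c n * r ^ n)\<^sup>2 * (real n ^ n)\<^sup>2 \<le> (c n * r ^ n)\<^sup>2 * (exp 1 ^ n * fact n)\<^sup>2"
      by (intro mult_left_mono power_mono power_self_le_exp_fact) auto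
    also have "\<dots> = (fact n * c n)\<^sup>2 * (r\<^sup>2 * (exp 1)\<^sup>2) ^ n"
      by (simp add: power_mult_distrib power2_eq_square algebra_simps)
    also have "\<dots> \<le> K\<^sup>2 * (real n * M) ^ n * (r\<^sup>2 * (exp 1)\<^sup>2) ^ n"
      using bound elim by (intro mult_right_mono) auto
    also have "\<dots> = K\<^sup>2 * (1 / 4 * (T * real n)) ^ n"
      by (simp add: T_def r_def power_mult_distrib algebra_simps)
    also have "\<dots> \<le> K\<^sup>2 * (1 / 4 * (real n * real n)) ^ n"
      using elim M by (intro mult_left_mono power_mono mult_right_mono) (auto simp: T_def)
    also have "\<dots> = (K * (1 / 2) ^ n)\<^sup>2 * (real n ^ n)\<^sup>2"
      by (simp add: power_mult_distrib power2_eq_square algebra_simps power_divide flip: power_mult_distrib)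
    finally have "(c n * r ^ n)\<^sup>2 \<le> (K * (1 / 2) ^ n)\<^sup>2"
      using n by (subst (asm) mult_le_cancel_right_pos) auto
    then have "\<bar>c n * r ^ n\<bar> \<le> \<bar>K * (1 / 2) ^ n\<bar>" by (simp add: abs_le_square_iff)
    then show ?case by (simp add: r_def norm_mult norm_power abs_mult)
  qed
  show "summable (\<lambda>n. \<bar>K\<bar> * (1 / 2 :: real) ^ n)" by (intro summable_mult summable_geometric) simp
qed

text \<open>Infinite radius of convergence turns the formal identity into one between values at
  every point, so each complex root of \<open>P\<close> is a root of \<open>D\<close>.\<close>

lemma complex_common_root:
  fixes P D :: "real poly"
  assumes cP: "c * fps_of_poly P = fps_of_poly D"
    and conv: "\<And>z::complex. summable (\<lambda>n. complex_of_real (fps_nth c n) * z ^ n)"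
    and deg: "degree P \<noteq> 0"
  obtains z :: complex where "poly (map_poly of_real P) z = 0" "poly (map_poly of_real D) z = 0"
proof -
  define C where "C = Abs_fps (\<lambda>n. complex_of_real (fps_nth c n))"
  have "degree (map_poly complex_of_real P) = degree P"
    by (rule degree_map_poly) auto
  then have "\<not> constant (poly (map_poly complex_of_real P))"
    using deg by (simp add: constant_degree)
  then obtain z where z: "poly (map_poly complex_of_real P) z = 0"
    using fundamental_theorem_of_algebra by blast
  have "C * fps_of_poly (map_poly of_real P) = fps_of_poly (map_poly of_real D)"
  proof (rule fps_ext)
    fix n
    have "complex_of_real (fps_nth (c * fps_of_poly P) n) = of_real (fps_nth (fps_of_poly D) n)"
      by (simp only: cP)
    then show "fps_nth (C * fps_of_poly (map_poly of_real P)) n = fps_nth (fps_of_poly (map_poly of_real D)) n"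
      by (simp add: C_def fps_mult_nth coeff_map_poly)
  qed
  then have "eval_fps (fps_of_poly (map_poly of_real D)) z = eval_fps (C * fps_of_poly (map_poly of_real P)) z"
    by (simp only:)
  also have "\<dots> = eval_fps C z * eval_fps (fps_of_poly (map_poly of_real P)) z"
  proof (rule eval_fps_mult)
    have "fps_conv_radius C = \<infinity>"
      unfolding fps_conv_radius_def C_def using conv by (intro conv_radius_inftyI'') simp
    then show "ereal (norm z) < fps_conv_radius C" by simp
  qed simp
  finally show ?thesis using z that by simp
qed

lemma map_poly_of_real_mult:
  "map_poly complex_of_real (p * q) = map_poly of_real p * map_poly of_real q"
  by (intro poly_eqI) (simp add: coeff_map_poly coeff_mult)

lemma poly_map_poly_of_real_prod:
  "poly (map_poly complex_of_real (prod f A)) z = (\<Prod>a\<in>A. poly (map_poly of_real (f a)) z)"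
  by (induction A rule: infinite_finite_induct) (simp_all add: map_poly_of_real_mult)

lemma poly_map_poly_of_real:
  "poly (map_poly complex_of_real p) (of_real x) = of_real (poly p x)"
  by (induction p) (simp_all add: map_poly_pCons)

section \<open>Schoenberg's theorem for exponential sums\<close>

definition exp_sum :: "real set \<Rightarrow> (real \<Rightarrow> real) \<Rightarrow> real \<Rightarrow> real" where
  "exp_sum \<Gamma> C x = (if x < 0 then 0 else \<Sum>\<gamma>\<in>\<Gamma>. C \<gamma> * exp (- \<gamma> * x))"

text \<open>The Laplace transform of \<open>exp_sum \<Gamma> C\<close> is \<open>numer_poly \<Gamma> C\<close> divided by \<open>\<Prod>\<gamma>\<in>\<Gamma>. [:\<gamma>, 1:]\<close>.\<close>

definition numer_poly :: "real set \<Rightarrow> (real \<Rightarrow> real) \<Rightarrow> real poly" where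
  "numer_poly \<Gamma> C = (\<Sum>l\<in>\<Gamma>. smult (C l) (\<Prod>\<gamma>\<in>\<Gamma> - {l}. [:\<gamma>, 1:]))"

lemma exp_sum_alt: "exp_sum \<Gamma> C x = (\<Sum>\<gamma>\<in>\<Gamma>. C \<gamma> * (indicator {0..} x * exp (- \<gamma> * x)))"
  by (simp add: exp_sum_def)

text \<open>Every other summand contains the factor \<open>[:l, 1:]\<close>. With all weights
  non-zero, the Laplace transform is therefore a reduced fraction.\<close>

lemma poly_numer_poly_neq_0:
  assumes "finite \<Gamma>" "l \<in> \<Gamma>" "C l \<noteq> 0"
  shows "poly (numer_poly \<Gamma> C) (- l) \<noteq> 0"
proof -
  have "poly (numer_poly \<Gamma> C) (- l) = (\<Sum>k\<in>{l}. C k * (\<Prod>\<gamma>\<in>\<Gamma> - {k}. \<gamma> - l))"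
    unfolding numer_poly_def poly_sum poly_smult poly_prod
    using assms by (intro sum.mono_neutral_cong_right) (auto intro!: prod_zero)
  then show ?thesis using assms by (auto simp: prod_zero_iff)
qed

text \<open>Convolution maps Q(D) w to P(D) w when P / Q is the Laplace transform: the exponential
  of rate \<open>l\<close> inverts the factor l + D of Q(D), and the products of the remaining
  factors add up to \<open>numer_poly\<close>.\<close>

lemma exp_sum_poly_integral:
  fixes w :: "real poly"
  assumes \<Gamma>: "finite \<Gamma>" "\<And>\<gamma>. \<gamma> \<in> \<Gamma> \<Longrightarrow> 0 < \<gamma>"
  defines "g \<equiv> diff_op (fps_of_poly (\<Prod>\<gamma>\<in>\<Gamma>. [:\<gamma>, 1:])) w"
  shows "integrable lborel (\<lambda>t. exp_sum \<Gamma> C (x - t) * poly g t)"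
    and "(\<integral>t. exp_sum \<Gamma> C (x - t) * poly g t \<partial>lborel) = poly (diff_op (fps_of_poly (numer_poly \<Gamma> C)) w) x"
proof -
  define v where "v l = diff_op (fps_of_poly (\<Prod>\<gamma>\<in>\<Gamma> - {l}. [:\<gamma>, 1:])) w" for l
  have g: "g = smult l (v l) + pderiv (v l)" if "l \<in> \<Gamma>" for l
  proof -
    have "(\<Prod>\<gamma>\<in>\<Gamma>. [:\<gamma>, 1:]) = [:l, 1:] * (\<Prod>\<gamma>\<in>\<Gamma> - {l}. [:\<gamma>, 1:])"
      using \<Gamma>(1) that by (rule prod.remove)
    then show ?thesis
      by (simp only: g_def v_def fps_of_poly_mult diff_op_mult diff_op_linear)
  qed
  define F where "F t = (\<Sum>l\<in>\<Gamma>. C l * (indicator {0..} t * (exp (- l * t) * poly g (x - t))))" for t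
  have F: "F t = exp_sum \<Gamma> C t * poly g (x - t)" for t
    by (simp add: F_def exp_sum_alt sum_distrib_right mult.assoc)
  have int: "integrable lborel (\<lambda>t. C l * (indicator {0..} t * (exp (- l * t) * poly g (x - t))))" if "l \<in> \<Gamma>" for l
    by (intro integrable_mult_right integrable_poly_exp \<Gamma>(2) that)
  have F_int: "integrable lborel F"
    unfolding F_def by (intro Bochner_Integration.integrable_sum int)
  have flip: "F (x + (-1) * t) = exp_sum \<Gamma> C (x - t) * poly g t" for t by (simp add: F)
  have "integrable lborel (\<lambda>t. F (x + (-1) * t))"
    using F_int by (subst lborel_integrable_real_affine_iff) simp_all
  then show "integrable lborel (\<lambda>t. exp_sum \<Gamma> C (x - t) * poly g t)"
    unfolding flip .
  have "(\<integral>t. exp_sum \<Gamma> C (x - t) * poly g t \<partial>lborel) = (\<integral>t. F t \<partial>lborel)"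
    using lborel_integral_real_affine[of "-1" F x] unfolding flip by simp
  also have "\<dots> = (\<Sum>l\<in>\<Gamma>. C l * (\<integral>t. indicator {0..} t * (exp (- l * t) * poly g (x - t)) \<partial>lborel))"
    unfolding F_def using int by (subst Bochner_Integration.integral_sum) (auto intro!: sum.cong)
  also have "\<dots> = (\<Sum>l\<in>\<Gamma>. C l * poly (v l) x)"
  proof (intro sum.cong refl)
    fix l assume l: "l \<in> \<Gamma>"
    show "C l * (\<integral>t. indicator {0..} t * (exp (- l * t) * poly g (x - t)) \<partial>lborel) = C l * poly (v l) x"
      using integral_exp_poly[OF \<Gamma>(2)[OF l], of "v l" x] unfolding g[OF l] by simp
  qed
  also have "\<dots> = poly (diff_op (fps_of_poly (numer_poly \<Gamma> C)) w) x"
    by (simp add: numer_poly_def v_def fps_of_poly_sum diff_op_sum fps_of_poly_smult diff_op_const_mult poly_sum)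
  finally show "(\<integral>t. exp_sum \<Gamma> C (x - t) * poly g t \<partial>lborel) = poly (diff_op (fps_of_poly (numer_poly \<Gamma> C)) w) x" .
qed

text \<open>The point lies half a step before \<open>\<epsilon> * i\<close>, so exactly
  \<open>n - i\<close> factors are negative.\<close>

lemma poly_equispaced_poly_sign:
  assumes "0 < \<epsilon>" "i \<le> n"
  shows "0 < (-1) ^ (n + i) * poly (equispaced_poly n \<epsilon>) (\<epsilon> * (real i - 1 / 2))"
  using assms(2)
proof (induction n rule: dec_induct)
  case base
  have "0 < (\<Prod>j<i. \<epsilon> * (real i - 1 / 2) - \<epsilon> * real j)"
  proof (rule prod_pos)
    fix j assume "j \<in> {..<i}"
    then have "real j \<le> real i - 1" by simp
    then have "\<epsilon> * real j < \<epsilon> * (real i - 1 / 2)" using assms(1) by (intro mult_strict_left_mono) auto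
    then show "0 < \<epsilon> * (real i - 1 / 2) - \<epsilon> * real j" by simp
  qed
  moreover have "(-1 :: real) ^ (i + i) = 1" by (simp flip: mult_2)
  ultimately show ?case by (simp add: equispaced_poly_def poly_prod)
next
  case (step n)
  have "\<epsilon> * (real i - 1 / 2) < \<epsilon> * real n"
    using assms(1) step(1) by (intro mult_strict_left_mono) auto
  then have "0 < \<epsilon> * real n - \<epsilon> * (real i - 1 / 2)" by simp
  with step.IH have "0 < ((-1) ^ (n + i) * poly (equispaced_poly n \<epsilon>) (\<epsilon> * (real i - 1 / 2))) *
      (\<epsilon> * real n - \<epsilon> * (real i - 1 / 2))" by (rule mult_pos_pos)
  then show ?case
    by (simp add: equispaced_poly_def poly_prod algebra_simps)
qed

lemma exp_sum_integral_pos: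
  assumes \<Gamma>: "finite \<Gamma>" "\<And>\<gamma>. \<gamma> \<in> \<Gamma> \<Longrightarrow> 0 < \<gamma>"
    and nonneg: "\<And>x. 0 \<le> exp_sum \<Gamma> C x" and nz: "exp_sum \<Gamma> C x0 \<noteq> 0"
  shows "0 < (\<integral>t. exp_sum \<Gamma> C t \<partial>lborel)"
proof -
  define S where "S x = (\<Sum>\<gamma>\<in>\<Gamma>. C \<gamma> * exp (- \<gamma> * x))" for x
  have x0: "0 \<le> x0" using nz by (auto simp: exp_sum_def split: if_splits)
  define e where "e = S x0 / 2"
  have e: "0 < e" using nonneg[of x0] nz x0 by (simp add: e_def exp_sum_def S_def)
  have "isCont S x0" unfolding S_def by (intro continuous_intros)
  then have "\<forall>\<^sub>F x in at x0. e < S x"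
    unfolding isCont_def by (rule order_tendstoD(1)) (use e in \<open>simp add: e_def\<close>)
  then obtain d where d: "0 < d" "\<And>x. x \<noteq> x0 \<Longrightarrow> dist x x0 < d \<Longrightarrow> e < S x"
    unfolding eventually_at by blast
  \<comment> \<open>The interval extends only to the right of \<open>x0\<close>, because the
    function may jump at 0.\<close>
  have ge: "indicator {x0..x0 + d / 2} x * e \<le> exp_sum \<Gamma> C x" for x
  proof (cases "x \<in> {x0..x0 + d / 2}")
    case True
    then have "e < S x" using d e by (cases "x = x0") (auto simp: e_def dist_real_def)
    then show ?thesis using True x0 by (simp add: exp_sum_def S_def)
  qed (use nonneg in simp)
  have int: "integrable lborel (exp_sum \<Gamma> C)"
    unfolding exp_sum_alt using \<Gamma>(2) integrable_power_exp[of _ 0]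
    by (intro Bochner_Integration.integrable_sum integrable_mult_right) simp_all
  have "0 < d / 2 * e" using d e by simp
  also have "\<dots> = (\<integral>t. indicator {x0..x0 + d / 2} t * e \<partial>lborel)" using d by simp
  also have "\<dots> \<le> (\<integral>t. exp_sum \<Gamma> C t \<partial>lborel)"
    using d by (intro integral_mono ge int integrable_mult_left integrable_real_indicator) auto
  finally show ?thesis .
qed

text \<open>Schoenberg's theorem on the reciprocal of the Laplace transform, for exponential sums.
  Convolution with the function is the operator \<open>P(D) / Q(D)\<close> on polynomials, where \<open>P / Q\<close> is the
  Laplace transform, and it does not increase the number of sign changes. Hence \<open>Q(D) / P(D)\<close>
  preserves real-rootedness, which forces the power series \<open>Q / P\<close> to be entire.\<close>

lemma degree_numer_poly_of_totally_nonneg: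
  assumes \<Gamma>: "finite \<Gamma>" "\<And>\<gamma>. \<gamma> \<in> \<Gamma> \<Longrightarrow> 0 < \<gamma>" and C: "\<And>\<gamma>. \<gamma> \<in> \<Gamma> \<Longrightarrow> C \<gamma> \<noteq> 0"
    and tn: "totally_nonneg (exp_sum \<Gamma> C)" and nz: "exp_sum \<Gamma> C x0 \<noteq> 0"
  shows "degree (numer_poly \<Gamma> C) = 0"
proof (rule ccontr)
  assume deg: "degree (numer_poly \<Gamma> C) \<noteq> 0"
  define P where "P = numer_poly \<Gamma> C"
  define Q where "Q = (\<Prod>\<gamma>\<in>\<Gamma>. [:\<gamma>, 1:])"
  have Q0: "0 < coeff Q 0"
    unfolding Q_def using \<Gamma> by (auto simp: poly_prod simp flip: poly_0_coeff_0 intro!: prod_pos)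
  have nonneg: "0 \<le> exp_sum \<Gamma> C x" for x using tn by (rule totally_nonneg_nonneg)
  have const: "diff_op (fps_of_poly p) 1 = [:coeff p 0:]" for p :: "real poly"
    by (simp add: diff_op_def)
  \<comment> \<open>The case \<open>w = 1\<close>: P(0) / Q(0) is the integral of the function,
    hence positive, so \<open>P\<close> is invertible as a formal power series.\<close>
  have "coeff P 0 = (\<integral>t. exp_sum \<Gamma> C (0 + (-1) * t) * coeff Q 0 \<partial>lborel)"
    using exp_sum_poly_integral(2)[OF \<Gamma>, where x = 0 and w = 1 and C = C]
    by (simp add: const P_def Q_def)
  also have "\<dots> = (\<integral>t. exp_sum \<Gamma> C t \<partial>lborel) * coeff Q 0"
    using lborel_integral_real_affine[of "-1" "exp_sum \<Gamma> C" 0] by simp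
  finally have P0: "coeff P 0 \<noteq> 0"
    using exp_sum_integral_pos[OF \<Gamma> nonneg nz] Q0 by simp
  define c where "c = fps_of_poly Q * inverse (fps_of_poly P)"
  have inv: "fps_of_poly P * inverse (fps_of_poly P) = 1"
    using P0 by (simp add: inverse_mult_eq_1')
  have cP: "c * fps_of_poly P = fps_of_poly Q"
    unfolding c_def using inv by (simp add: mult.assoc mult.commute)
  have c0: "fps_nth c 0 \<noteq> 0" using P0 Q0 by (simp add: c_def)
  have roots: "n \<le> card {z. poly (diff_op c (equispaced_poly n \<epsilon>)) z = 0}" if \<epsilon>: "0 < \<epsilon>" for n \<epsilon>
  proof (rule totally_nonneg_alternation_roots[OF tn])
    \<comment> \<open>With this \<open>w\<close>, convolution maps c(D) h back to h, the equispaced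
      polynomial. The \<open>n\<close> sign changes of h then force \<open>n\<close> real roots of
      c(D) h.\<close>
    define w where "w = diff_op (inverse (fps_of_poly P)) (equispaced_poly n \<epsilon>)"
    have g: "diff_op c (equispaced_poly n \<epsilon>) = diff_op (fps_of_poly Q) w"
      by (simp add: c_def w_def diff_op_mult)
    have h: "diff_op (fps_of_poly P) w = equispaced_poly n \<epsilon>"
      by (simp add: w_def inv flip: diff_op_mult)
    show "diff_op c (equispaced_poly n \<epsilon>) \<noteq> 0"
      using coeff_diff_op_equispaced_lead[of c n \<epsilon>] c0 by auto
    show "integrable lborel (\<lambda>t. exp_sum \<Gamma> C (x - t) * poly (diff_op c (equispaced_poly n \<epsilon>)) t)" for x
      unfolding g Q_def by (rule exp_sum_poly_integral(1)[OF \<Gamma>])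
    show "strict_mono_on {..n} (\<lambda>i. \<epsilon> * (real i - 1 / 2))"
      using \<epsilon> by (auto simp: strict_mono_on_def)
    fix i assume "i \<le> n"
    then have "0 < (-1) ^ (n + i) * poly (equispaced_poly n \<epsilon>) (\<epsilon> * (real i - 1 / 2))"
      by (rule poly_equispaced_poly_sign[OF \<epsilon>])
    also have "poly (equispaced_poly n \<epsilon>) (\<epsilon> * (real i - 1 / 2)) =
        (\<integral>t. exp_sum \<Gamma> C (\<epsilon> * (real i - 1 / 2) - t) * poly (diff_op c (equispaced_poly n \<epsilon>)) t \<partial>lborel)"
      unfolding g Q_def by (subst exp_sum_poly_integral(2)[OF \<Gamma>]) (simp_all add: h flip: P_def)
    finally show "0 < (-1) ^ n * (-1) ^ i *
        (\<integral>t. exp_sum \<Gamma> C (\<epsilon> * (real i - 1 / 2) - t) * poly (diff_op c (equispaced_poly n \<epsilon>)) t \<partial>lborel)"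
      by (simp only: power_add)
  qed
  define M where "M = (fps_nth c 1 / fps_nth c 0)\<^sup>2 + 2 * \<bar>fps_nth c 2 / fps_nth c 0\<bar>"
  have "(fact n * fps_nth c n)\<^sup>2 \<le> (fps_nth c 0)\<^sup>2 * (real n * M) ^ n" if "2 \<le> n" for n
  proof -
    have "(fact n * fps_nth c n / fps_nth c 0)\<^sup>2 \<le> (real n * M) ^ n"
      unfolding M_def using c0 that roots by (rule fps_coeff_bound_of_real_rooted)
    then show ?thesis using c0 by (simp add: power_divide field_simps)
  qed
  moreover have "0 \<le> M" unfolding M_def by (intro add_nonneg_nonneg) simp_all
  ultimately have conv: "summable (\<lambda>n. complex_of_real (fps_nth c n) * z ^ n)" for z
    by (rule summable_of_coeff_bound)
  \<comment> \<open>Since \<open>P\<close> is not constant, an entire Q / P needs a common root; it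
    can only be some \<open>- l\<close>, where the numerator does not vanish.\<close>
  obtain z :: complex where z: "poly (map_poly of_real P) z = 0" "poly (map_poly of_real Q) z = 0"
    using complex_common_root[OF cP conv] deg unfolding P_def by blast
  then have "(\<Prod>\<gamma>\<in>\<Gamma>. of_real \<gamma> + z) = 0"
    by (simp add: Q_def poly_map_poly_of_real_prod map_poly_pCons)
  then obtain l where l: "l \<in> \<Gamma>" "of_real l + z = 0" using \<Gamma>(1) by auto
  then have "z = of_real (- l)" by (simp add: eq_neg_iff_add_eq_0 add.commute)
  then have "poly P (- l) = 0" using z(1) by (simp only: poly_map_poly_of_real of_real_eq_0_iff)
  then show False
    using poly_numer_poly_neq_0[of \<Gamma> l C] \<Gamma>(1) C[OF l(1)] l(1) by (simp add: P_def)
qed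

text \<open>Each factor \<open>s\<close> in \<open>s ^ k * numer_poly \<Gamma> C\<close> can be traded for a factor \<open>- \<gamma>\<close> in the
  coefficients, as long as the previous moments vanish.\<close>

lemma moments_zero_of_numer_poly_const:
  assumes \<Gamma>: "finite \<Gamma>" and deg: "degree (numer_poly \<Gamma> C) = 0"
  shows "Suc k < card \<Gamma> \<Longrightarrow> (\<Sum>\<gamma>\<in>\<Gamma>. C \<gamma> * (- \<gamma>) ^ k) = 0"
proof -
  define N where "N k = numer_poly \<Gamma> (\<lambda>\<gamma>. C \<gamma> * (- \<gamma>) ^ k)" for k
  define m where "m k = (\<Sum>\<gamma>\<in>\<Gamma>. C \<gamma> * (- \<gamma>) ^ k)" for k
  have coeff_N: "coeff (N k) (card \<Gamma> - 1) = m k" for k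
  proof -
    have "coeff (\<Prod>\<gamma>\<in>\<Gamma> - {l}. [:\<gamma>, 1:]) (card \<Gamma> - 1) = 1" if "l \<in> \<Gamma>" for l
    proof -
      have "degree (\<Prod>\<gamma>\<in>\<Gamma> - {l}. [:\<gamma>, 1:]) = card \<Gamma> - 1"
        using \<Gamma> that by (subst degree_prod_sum_eq) auto
      moreover have "lead_coeff (\<Prod>\<gamma>\<in>\<Gamma> - {l}. [:\<gamma>, 1:]) = 1" by (simp add: lead_coeff_prod)
      ultimately show ?thesis by simp
    qed
    then show ?thesis by (simp add: N_def numer_poly_def m_def coeff_sum)
  qed
  have step: "N (Suc k) = pCons 0 (N k) - smult (m k) (\<Prod>\<gamma>\<in>\<Gamma>. [:\<gamma>, 1:])" for k
  proof -
    have "[:0, 1:] * smult a R - smult (a * - l) R = smult a ([:l, 1:] * R)" for a l :: real and R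
      by (simp add: smult_add_right)
    then have "[:0, 1:] * N k - N (Suc k) =
        (\<Sum>l\<in>\<Gamma>. smult (C l * (- l) ^ k) ([:l, 1:] * (\<Prod>\<gamma>\<in>\<Gamma> - {l}. [:\<gamma>, 1:])))"
      unfolding N_def numer_poly_def sum_distrib_left sum_subtractf[symmetric]
      by (intro sum.cong refl) (simp only: power_Suc2 mult.assoc[symmetric])
    also have "\<dots> = (\<Sum>l\<in>\<Gamma>. smult (C l * (- l) ^ k) (\<Prod>\<gamma>\<in>\<Gamma>. [:\<gamma>, 1:]))"
      by (intro sum.cong refl) (simp only: prod.remove[OF \<Gamma>])
    also have "\<dots> = smult (m k) (\<Prod>\<gamma>\<in>\<Gamma>. [:\<gamma>, 1:])" by (simp add: m_def smult_sum)
    finally show ?thesis by (simp add: algebra_simps)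
  qed
  \<comment> \<open>\<open>N 0\<close> is constant, and a step with vanishing moment raises the
    degree by at most 1. While \<open>k < card \<Gamma> - 1\<close>, the coefficient holding the
    moment lies above the degree.\<close>
  have main: "degree (N k) \<le> k \<and> m k = 0" if "Suc k < card \<Gamma>" for k
    using that
  proof (induction k)
    case 0
    then show ?case using deg coeff_N[of 0] by (simp add: N_def coeff_eq_0)
  next
    case (Suc k)
    then have "N (Suc k) = pCons 0 (N k)" using step[of k] by simp
    then have "degree (N (Suc k)) \<le> Suc k"
      using Suc degree_pCons_le[of 0 "N k"] by simp
    moreover from this have "coeff (N (Suc k)) (card \<Gamma> - 1) = 0"
      using Suc.prems by (intro coeff_eq_0) simp
    ultimately show ?case using coeff_N[of "Suc k"] by simp
  qed
  show "Suc k < card \<Gamma> \<Longrightarrow> (\<Sum>\<gamma>\<in>\<Gamma>. C \<gamma> * (- \<gamma>) ^ k) = 0"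
    using main[of k] by (simp add: m_def)
qed

section \<open>The hypoexponential density\<close>

text \<open>For distinct rates, the residue at - \<beta> j of the product over \<open>J\<close> of
  \<beta> i / (\<beta> i + s).\<close>

definition hypo_coeff :: "('i \<Rightarrow> real) \<Rightarrow> 'i set \<Rightarrow> 'i \<Rightarrow> real" where
  "hypo_coeff \<beta> J j = (\<Prod>i\<in>J. \<beta> i) / (\<Prod>i\<in>J - {j}. \<beta> i - \<beta> j)"

text \<open>The index set is a parameter so that variables can be added one at a time.\<close>

definition hypo_exp_sum :: "('i \<Rightarrow> real) \<Rightarrow> 'i set \<Rightarrow> real \<Rightarrow> real" where
  "hypo_exp_sum \<beta> J x = (if x < 0 then 0 else \<Sum>j\<in>J. hypo_coeff \<beta> J j * exp (- \<beta> j * x))"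

text \<open>Adding the rate \<open>\<beta> k\<close> uses the expansion over \<open>J\<close> twice,
  at \<open>s\<close> and at \<open>\<beta> k\<close>. The latter turns the new residue into a sum
  over \<open>J\<close>, and the two sums combine term by term.\<close>

lemma partial_fractions:
  fixes \<beta> :: "'i \<Rightarrow> real"
  assumes "finite J" "J \<noteq> {}" "inj_on \<beta> J" "\<And>i. i \<in> J \<Longrightarrow> \<beta> i \<noteq> s"
  shows "(\<Sum>j\<in>J. 1 / ((\<Prod>i\<in>J - {j}. \<beta> i - \<beta> j) * (\<beta> j - s))) = 1 / (\<Prod>i\<in>J. \<beta> i - s)"
  using assms
proof (induction J arbitrary: s rule: finite_ne_induct)
  case (singleton k)
  then show ?case by simp
next
  case (insert k J)
  define e where "e j = 1 / (\<Prod>i\<in>J - {j}. \<beta> i - \<beta> j)" for j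
  have inj: "inj_on \<beta> J" and ne: "\<beta> j \<noteq> \<beta> k" if "j \<in> J" for j
    using insert that by (auto simp: inj_on_def)
  have IH: "(\<Sum>j\<in>J. e j / (\<beta> j - t)) = 1 / (\<Prod>i\<in>J. \<beta> i - t)" if "\<And>i. i \<in> J \<Longrightarrow> \<beta> i \<noteq> t" for t
    using insert.IH[of t] that insert.prems(1) by (simp add: e_def)
  have "(\<Prod>i\<in>insert k J - {j}. \<beta> i - \<beta> j) = (\<beta> k - \<beta> j) * (\<Prod>i\<in>J - {j}. \<beta> i - \<beta> j)" if "j \<in> J" for j
  proof -
    have "insert k J - {j} = insert k (J - {j})" using insert that by auto
    then show ?thesis using insert by simp
  qed
  then have "(\<Sum>j\<in>J. 1 / ((\<Prod>i\<in>insert k J - {j}. \<beta> i - \<beta> j) * (\<beta> j - s))) =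
      (\<Sum>j\<in>J. e j / ((\<beta> k - \<beta> j) * (\<beta> j - s)))"
    by (intro sum.cong) (auto simp: e_def)
  moreover have "1 / ((\<Prod>i\<in>insert k J - {k}. \<beta> i - \<beta> k) * (\<beta> k - s)) = (\<Sum>j\<in>J. e j / ((\<beta> j - \<beta> k) * (\<beta> k - s)))"
  proof -
    have "insert k J - {k} = J" using insert by auto
    then have "1 / ((\<Prod>i\<in>insert k J - {k}. \<beta> i - \<beta> k) * (\<beta> k - s)) = 1 / (\<Prod>i\<in>J. \<beta> i - \<beta> k) / (\<beta> k - s)"
      by simp
    also have "\<dots> = (\<Sum>j\<in>J. e j / (\<beta> j - \<beta> k)) / (\<beta> k - s)"
      by (subst IH) (use ne in auto)
    finally show ?thesis by (simp add: sum_divide_distrib)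
  qed
  ultimately have "(\<Sum>j\<in>insert k J. 1 / ((\<Prod>i\<in>insert k J - {j}. \<beta> i - \<beta> j) * (\<beta> j - s))) =
      (\<Sum>j\<in>J. e j / ((\<beta> j - \<beta> k) * (\<beta> k - s)) + e j / ((\<beta> k - \<beta> j) * (\<beta> j - s)))"
    using insert by (simp add: sum.distrib)
  also have "\<dots> = (\<Sum>j\<in>J. e j / (\<beta> j - s) / (\<beta> k - s))"
  proof (intro sum.cong refl)
    fix j assume j: "j \<in> J"
    have "\<beta> j - \<beta> k \<noteq> 0" "\<beta> k - \<beta> j \<noteq> 0" "\<beta> j - s \<noteq> 0" "\<beta> k - s \<noteq> 0"
      using ne[OF j] insert.prems(2) j by auto
    then show "e j / ((\<beta> j - \<beta> k) * (\<beta> k - s)) + e j / ((\<beta> k - \<beta> j) * (\<beta> j - s)) = e j / (\<beta> j - s) / (\<beta> k - s)"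
      by (simp add: divide_simps) (simp add: algebra_simps)
  qed
  also have "\<dots> = 1 / (\<Prod>i\<in>J. \<beta> i - s) / (\<beta> k - s)"
  proof -
    have "(\<Sum>j\<in>J. e j / (\<beta> j - s)) = 1 / (\<Prod>i\<in>J. \<beta> i - s)"
      by (rule IH) (simp add: insert.prems(2))
    then show ?thesis by (simp only: sum_divide_distrib[symmetric])
  qed
  also have "\<dots> = 1 / (\<Prod>i\<in>insert k J. \<beta> i - s)" using insert by simp
  finally show ?case .
qed

lemma hypo_coeff_insert_old:
  assumes "finite J" "k \<notin> J" "j \<in> J"
  shows "hypo_coeff \<beta> (insert k J) j = hypo_coeff \<beta> J j * \<beta> k / (\<beta> k - \<beta> j)"
proof -
  have "insert k J - {j} = insert k (J - {j})" using assms by auto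
  then show ?thesis using assms by (simp add: hypo_coeff_def mult.commute)
qed

text \<open>The expansion over \<open>J\<close> at the point \<open>s = \<beta> k\<close>. Together
  with \<open>hypo_coeff_insert_old\<close> it makes all coefficients add up to zero.\<close>

lemma hypo_coeff_insert_new:
  assumes J: "finite J" "J \<noteq> {}" "k \<notin> J" "inj_on \<beta> (insert k J)"
  shows "hypo_coeff \<beta> (insert k J) k = - (\<Sum>j\<in>J. hypo_coeff \<beta> J j * \<beta> k / (\<beta> k - \<beta> j))"
proof -
  have "insert k J - {k} = J" using J by auto
  then have "hypo_coeff \<beta> (insert k J) k = \<beta> k * (\<Prod>i\<in>J. \<beta> i) * (1 / (\<Prod>i\<in>J. \<beta> i - \<beta> k))"
    using J by (simp add: hypo_coeff_def)
  also have "\<dots> = \<beta> k * (\<Prod>i\<in>J. \<beta> i) * (\<Sum>j\<in>J. 1 / ((\<Prod>i\<in>J - {j}. \<beta> i - \<beta> j) * (\<beta> j - \<beta> k)))"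
    using J by (subst partial_fractions) (auto simp: inj_on_def)
  also have "\<dots> = - (\<Sum>j\<in>J. hypo_coeff \<beta> J j * \<beta> k / (\<beta> k - \<beta> j))"
    unfolding sum_distrib_left sum_negf[symmetric]
  proof (intro sum.cong refl)
    fix j assume "j \<in> J"
    then have "\<beta> j - \<beta> k \<noteq> 0" "\<beta> k - \<beta> j \<noteq> 0" using J by (auto simp: inj_on_def)
    then show "\<beta> k * (\<Prod>i\<in>J. \<beta> i) * (1 / ((\<Prod>i\<in>J - {j}. \<beta> i - \<beta> j) * (\<beta> j - \<beta> k))) =
        - (hypo_coeff \<beta> J j * \<beta> k / (\<beta> k - \<beta> j))"
      by (simp add: hypo_coeff_def divide_simps) (simp add: algebra_simps)
  qed
  finally show ?thesis .
qed

lemma sum_hypo_coeff_eq_0: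
  assumes J: "finite J" "2 \<le> card J" "inj_on \<beta> J"
  shows "(\<Sum>j\<in>J. hypo_coeff \<beta> J j) = 0"
proof -
  from J obtain k where k: "k \<in> J" by fastforce
  define K where "K = J - {k}"
  have K: "finite K" "k \<notin> K" "J = insert k K" using J k by (auto simp: K_def)
  then have "K \<noteq> {}" using J by auto
  then show ?thesis
    using K J hypo_coeff_insert_new[of K k \<beta>] hypo_coeff_insert_old[OF K(1,2), of _ \<beta>] by simp
qed

lemma hypo_coeff_neq_0:
  assumes "finite J" "inj_on \<beta> J" "\<And>i. i \<in> J \<Longrightarrow> 0 < \<beta> i" "j \<in> J"
  shows "hypo_coeff \<beta> J j \<noteq> 0"
  using assms by (force simp: hypo_coeff_def inj_on_def)

lemma continuous_hypo_exp_sum: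
  assumes J: "finite J" "2 \<le> card J" "inj_on \<beta> J"
  shows "continuous_on UNIV (hypo_exp_sum \<beta> J)"
proof -
  \<comment> \<open>Clamping the argument at 0 yields the value 0 on the negative side because the
    coefficients sum to zero.\<close>
  have "hypo_exp_sum \<beta> J = (\<lambda>x. \<Sum>j\<in>J. hypo_coeff \<beta> J j * exp (- \<beta> j * max x 0))"
    using sum_hypo_coeff_eq_0[OF J] by (auto simp: hypo_exp_sum_def max_def)
  then show ?thesis by (auto intro!: continuous_intros)
qed

text \<open>\<open>F\<close> is an antiderivative of the convolution integrand between 0 and
  \<open>x\<close>. Non-negativity, which the signed coefficients do not show, follows because
  \<open>F\<close> increases.\<close>

lemma hypo_exp_sum_convolution:
  fixes \<beta> :: "'i \<Rightarrow> real"
  assumes J: "finite J" "J \<noteq> {}" "k \<notin> J" "inj_on \<beta> (insert k J)" and pos: "0 < \<beta> k"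
    and nonneg: "\<And>x. 0 \<le> hypo_exp_sum \<beta> J x"
  shows "(\<integral>\<^sup>+y. ennreal (exponential_density (\<beta> k) (x - y)) * ennreal (hypo_exp_sum \<beta> J y) \<partial>lborel) =
      ennreal (hypo_exp_sum \<beta> (insert k J) x)"
    and "0 \<le> hypo_exp_sum \<beta> (insert k J) x"
proof -
  define c where "c j = hypo_coeff \<beta> J j" for j
  define q where "q y = (\<Sum>j\<in>J. c j * exp (- \<beta> j * y)) * (\<beta> k * exp (- \<beta> k * (x - y)))" for y
  define a where "a j = c j * \<beta> k / (\<beta> k - \<beta> j)" for j
  define F where "F y = (\<Sum>j\<in>J. a j * (exp (- \<beta> k * x) * exp ((\<beta> k - \<beta> j) * y)))" for y
  have ne: "\<beta> k - \<beta> j \<noteq> 0" if "j \<in> J" for j using J that by (auto simp: inj_on_def)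
  have F: "DERIV F y :> q y" for y
  proof -
    have "q y = (\<Sum>j\<in>J. a j * (exp (- \<beta> k * x) * (exp ((\<beta> k - \<beta> j) * y) * (\<beta> k - \<beta> j))))"
      unfolding q_def sum_distrib_right using ne
      by (intro sum.cong refl) (simp add: a_def exp_diff exp_minus exp_add field_simps)
    then show ?thesis unfolding F_def by (auto intro!: derivative_eq_intros sum.cong)
  qed
  have q_nonneg: "0 \<le> q y" if "0 \<le> y" for y
    using nonneg[of y] that pos by (simp add: q_def hypo_exp_sum_def c_def)
  have value_F: "F x - F 0 = hypo_exp_sum \<beta> (insert k J) x" if "0 \<le> x"
  proof -
    have "hypo_exp_sum \<beta> (insert k J) x =
        hypo_coeff \<beta> (insert k J) k * exp (- \<beta> k * x) + (\<Sum>j\<in>J. hypo_coeff \<beta> (insert k J) j * exp (- \<beta> j * x))"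
      using that J by (simp add: hypo_exp_sum_def)
    also have "\<dots> = - (\<Sum>j\<in>J. a j) * exp (- \<beta> k * x) + (\<Sum>j\<in>J. a j * exp (- \<beta> j * x))"
      using J hypo_coeff_insert_old[OF J(1,3), of _ \<beta>] by (simp add: hypo_coeff_insert_new a_def c_def)
    also have "\<dots> = (\<Sum>j\<in>J. a j * exp (- \<beta> j * x) - a j * exp (- \<beta> k * x))"
      by (simp add: sum_subtractf sum_distrib_right)
    also have "\<dots> = F x - F 0"
    proof -
      have "exp (- \<beta> k * x) * exp ((\<beta> k - \<beta> j) * x) = exp (- \<beta> j * x)" for j
        unfolding mult_exp_exp by (simp add: algebra_simps)
      then show ?thesis unfolding F_def sum_subtractf[symmetric] by simp
    qed
    finally show ?thesis by simp
  qed
  show "0 \<le> hypo_exp_sum \<beta> (insert k J) x"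
  proof (cases "0 \<le> x")
    case True
    then have "F 0 \<le> F x"
    proof (rule DERIV_nonneg_imp_nondecreasing)
      fix y :: real assume "0 \<le> y"
      then show "\<exists>d. DERIV F y :> d \<and> 0 \<le> d" using F q_nonneg by blast
    qed
    then show ?thesis using value_F[OF True] by simp
  qed (simp add: hypo_exp_sum_def)
  show "(\<integral>\<^sup>+y. ennreal (exponential_density (\<beta> k) (x - y)) * ennreal (hypo_exp_sum \<beta> J y) \<partial>lborel) =
      ennreal (hypo_exp_sum \<beta> (insert k J) x)"
  proof (cases "0 \<le> x")
    case True
    have "(\<integral>\<^sup>+y. ennreal (exponential_density (\<beta> k) (x - y)) * ennreal (hypo_exp_sum \<beta> J y) \<partial>lborel) =
        (\<integral>\<^sup>+y. ennreal (q y) * indicator {0..x} y \<partial>lborel)"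
    proof (intro nn_integral_cong)
      fix y
      show "ennreal (exponential_density (\<beta> k) (x - y)) * ennreal (hypo_exp_sum \<beta> J y) = ennreal (q y) * indicator {0..x} y"
      proof (cases "y \<in> {0..x}")
        case True
        then have "exponential_density (\<beta> k) (x - y) * hypo_exp_sum \<beta> J y = q y"
          by (simp add: exponential_density_def hypo_exp_sum_def q_def c_def algebra_simps)
        then show ?thesis
          using True nonneg[of y] pos by (simp add: erlang_density_nonneg flip: ennreal_mult)
      next
        case False
        then have "exponential_density (\<beta> k) (x - y) = 0 \<or> hypo_exp_sum \<beta> J y = 0"
          by (auto simp: exponential_density_def hypo_exp_sum_def)
        then show ?thesis using False by auto
      qed
    qed
    also have "\<dots> = ennreal (F x - F 0)"
    proof (rule nn_integral_FTC_Icc)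
      show "q \<in> borel_measurable borel" unfolding q_def by measurable
    qed (use True F q_nonneg in simp_all)
    finally show ?thesis using value_F[OF True] by simp
  next
    case False
    then have "(\<lambda>y. ennreal (exponential_density (\<beta> k) (x - y)) * ennreal (hypo_exp_sum \<beta> J y)) = (\<lambda>_. 0)"
      by (auto simp: exponential_density_def hypo_exp_sum_def)
    then show ?thesis using False by (simp add: hypo_exp_sum_def)
  qed
qed

section \<open>The law of a weighted sum of independent exponential variables\<close>

lemma indep_vars_PiM_coordinates:
  fixes N :: "'i::finite \<Rightarrow> real measure"
  assumes N: "\<And>i. prob_space (N i)" "\<And>i. sets (N i) = sets borel"
  shows "prob_space.indep_vars (Pi\<^sub>M UNIV N) (\<lambda>_. borel) (\<lambda>i \<omega>. \<omega> i) UNIV"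
proof -
  interpret prob_space "Pi\<^sub>M UNIV N" by (rule prob_space_PiM[OF N(1)])
  have rv: "(\<lambda>\<omega>. \<omega> i) \<in> Pi\<^sub>M UNIV N \<rightarrow>\<^sub>M borel" for i
    using measurable_component_singleton[of i UNIV N] by (simp add: measurable_cong_sets[OF refl N(2)])
  have "distr (Pi\<^sub>M UNIV N) borel (\<lambda>\<omega>. \<omega> i) = N i" for i
  proof -
    have "distr (Pi\<^sub>M UNIV N) borel (\<lambda>\<omega>. \<omega> i) = distr (Pi\<^sub>M UNIV N) (N i) (\<lambda>\<omega>. \<omega> i)"
      by (rule distr_cong) (simp_all add: N(2))
    also have "\<dots> = N i" by (rule distr_PiM_component) (simp_all add: N(1))
    finally show ?thesis .
  qed
  moreover have "distr (Pi\<^sub>M UNIV N) (Pi\<^sub>M UNIV (\<lambda>_. borel)) (\<lambda>\<omega>. \<omega>) = Pi\<^sub>M UNIV N"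
    by (rule distr_id2) (intro sets_PiM_cong, simp_all add: N(2))
  ultimately show ?thesis
    by (subst indep_vars_iff_distr_eq_PiM) (simp_all add: rv restrict_def)
qed

text \<open>Scaling by \<open>1 / \<beta> j\<close> gives an exponential variable of rate
  \<open>\<beta> j\<close>, and each new variable is convolved with the partial sum. Non-negativity
  is part of the induction because \<open>ennreal\<close> would hide negative values.\<close>

lemma distributed_exponential_sum:
  fixes \<beta> :: "'i::finite \<Rightarrow> real"
  assumes pos: "\<And>i. 0 < \<beta> i" and inj: "inj \<beta>" and J: "J \<noteq> {}"
  shows "distributed (\<Pi>\<^sub>M j\<in>UNIV. density lborel (exponential_density 1)) lborel
      (\<lambda>\<omega>. \<Sum>j\<in>J. 1 / \<beta> j * \<omega> j) (\<lambda>x. ennreal (hypo_exp_sum \<beta> J x)) \<and> (\<forall>x. 0 \<le> hypo_exp_sum \<beta> J x)"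
proof -
  define N where "N = density lborel (exponential_density 1)"
  define P where "P = (\<Pi>\<^sub>M j\<in>(UNIV::'i set). N)"
  have N: "prob_space N" "sets N = sets borel"
    by (simp_all add: N_def prob_space_exponential_density)
  interpret prob_space P unfolding P_def by (rule prob_space_PiM) (rule N(1))
  have "indep_vars (\<lambda>_. borel) (\<lambda>i \<omega>. \<omega> i) UNIV"
    unfolding P_def by (rule indep_vars_PiM_coordinates) (rule N)+
  then have indep: "indep_vars (\<lambda>_. borel) (\<lambda>i \<omega>. 1 / \<beta> i * \<omega> i) UNIV"
    by (rule indep_vars_compose2) simp
  have single: "distributed P lborel (\<lambda>\<omega>. 1 / \<beta> i * \<omega> i) (\<lambda>x. ennreal (exponential_density (\<beta> i) x))" for i
  proof -
    have meas: "(\<lambda>\<omega>. \<omega> i) \<in> P \<rightarrow>\<^sub>M lborel"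
      unfolding P_def using measurable_component_singleton[of i UNIV "\<lambda>_. N"]
      by (simp add: measurable_cong_sets[OF refl N(2)])
    have "distr P lborel (\<lambda>\<omega>. \<omega> i) = distr P N (\<lambda>\<omega>. \<omega> i)"
      by (rule distr_cong) (simp_all add: N(2))
    also have "\<dots> = N" unfolding P_def by (rule distr_PiM_component) (simp_all add: N(1))
    finally have "distributed P lborel (\<lambda>\<omega>. \<omega> i) (\<lambda>x. ennreal (exponential_density 1 x))"
      unfolding distributed_def using meas by (simp add: N_def)
    then have "distributed P lborel (\<lambda>\<omega>. 0 + 1 / \<beta> i * \<omega> i)
        (\<lambda>x. ennreal (exponential_density 1 ((x - 0) / (1 / \<beta> i))) / ennreal \<bar>1 / \<beta> i\<bar>)"
      by (rule distributed_affine) (use pos[of i] in simp)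
    moreover have "ennreal (exponential_density 1 ((x - 0) / (1 / \<beta> i))) / ennreal \<bar>1 / \<beta> i\<bar> =
        ennreal (exponential_density (\<beta> i) x)" for x
      using pos[of i]
      by (subst divide_ennreal) (auto simp: exponential_density_def mult_less_0_iff mult.commute)
    ultimately show ?thesis by simp
  qed
  have "distributed P lborel (\<lambda>\<omega>. \<Sum>j\<in>J. 1 / \<beta> j * \<omega> j) (\<lambda>x. ennreal (hypo_exp_sum \<beta> J x)) \<and>
      (\<forall>x. 0 \<le> hypo_exp_sum \<beta> J x)"
    using finite[of J] J
  proof (induction J rule: finite_ne_induct)
    case (singleton k)
    have "hypo_exp_sum \<beta> {k} x = exponential_density (\<beta> k) x" for x
      by (simp add: hypo_exp_sum_def exponential_density_def hypo_coeff_def mult.commute)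
    then show ?case using single[of k] pos[of k] by (simp add: erlang_density_nonneg)
  next
    case (insert k J)
    have inj': "inj_on \<beta> (insert k J)" using inj by (rule inj_on_subset) simp
    have nonneg: "0 \<le> hypo_exp_sum \<beta> J x" for x using insert.IH by simp
    note conv = hypo_exp_sum_convolution[OF insert.hyps(1,2,3) inj' pos nonneg]
    have "indep_var borel (\<lambda>\<omega>. 1 / \<beta> k * \<omega> k) borel (\<lambda>\<omega>. \<Sum>j\<in>J. 1 / \<beta> j * \<omega> j)"
      using insert.hyps indep_vars_subset[OF indep, of "insert k J"] by (intro indep_vars_sum) auto
    then have "distributed P lborel (\<lambda>\<omega>. 1 / \<beta> k * \<omega> k + (\<Sum>j\<in>J. 1 / \<beta> j * \<omega> j))
        (\<lambda>x. \<integral>\<^sup>+y. ennreal (exponential_density (\<beta> k) (x - y)) * ennreal (hypo_exp_sum \<beta> J y) \<partial>lborel)"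
      using single insert.IH by (intro distributed_convolution) simp_all
    then show ?case using insert.hyps conv by simp
  qed
  then show ?thesis by (simp add: P_def N_def)
qed

text \<open>The set of disagreement is open, and a non-empty open set is not negligible.\<close>

lemma continuous_AE_eq:
  fixes f g :: "real \<Rightarrow> real"
  assumes "continuous_on UNIV f" "continuous_on UNIV g" "AE x in lborel. f x = g x"
  shows "f = g"
proof -
  have "open {x. f x \<noteq> g x}"
    using assms by (intro open_Collect_neq)
  moreover from this have "{x. f x \<noteq> g x} \<in> null_sets lborel"
    using assms(3) by (subst AE_iff_null_sets) auto
  then have "negligible {x. f x \<noteq> g x}"
    by (simp add: negligible_iff_null_sets null_sets_completionI)
  ultimately show ?thesis using open_not_negligible by blast
qed

lemma hypoexp_density_eq:
  fixes \<alpha> :: "real ^ 'm::finite"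
  assumes pos: "\<And>j. 0 < \<alpha> $ j" and inj: "inj (\<lambda>j. 1 / \<alpha> $ j)" and card: "2 \<le> CARD('m)"
  shows "hypoexp_density \<alpha> = hypo_exp_sum (\<lambda>j. 1 / \<alpha> $ j) UNIV" (is "_ = ?h")
    and "0 \<le> hypoexp_density \<alpha> x"
    and "\<exists>x. hypoexp_density \<alpha> x \<noteq> 0"
proof -
  define P where "P = (\<Pi>\<^sub>M j\<in>(UNIV::'m set). density lborel (exponential_density 1))"
  interpret prob_space P unfolding P_def by (rule prob_space_PiM) (simp add: prob_space_exponential_density)
  have cont: "continuous_on UNIV ?h" using inj card by (intro continuous_hypo_exp_sum) auto
  have dist: "distributed P lborel (\<lambda>X. \<Sum>j\<in>UNIV. \<alpha> $ j * X j) (\<lambda>x. ennreal (?h x))" and nonneg: "0 \<le> ?h x" for x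
    using distributed_exponential_sum[OF _ inj, of UNIV] pos by (simp_all add: P_def)
  show eq: "hypoexp_density \<alpha> = ?h"
    unfolding hypoexp_density_def P_def[symmetric]
  proof (rule the_equality)
    show "continuous_on UNIV ?h \<and> (\<forall>x. 0 \<le> ?h x) \<and>
        distributed P lborel (\<lambda>X. \<Sum>j\<in>UNIV. \<alpha> $ j * X j) (\<lambda>x. ennreal (?h x))"
      using cont nonneg dist by blast
  next
    fix f assume f: "continuous_on UNIV f \<and> (\<forall>x. 0 \<le> f x) \<and>
        distributed P lborel (\<lambda>X. \<Sum>j\<in>UNIV. \<alpha> $ j * X j) (\<lambda>x. ennreal (f x))"
    then have "AE x in lborel. ennreal (f x) = ennreal (?h x)"
      using dist by (intro distributed_unique) auto
    then have "AE x in lborel. f x = ?h x"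
      using f nonneg by (simp add: ennreal_inj)
    then show "f = ?h" using f cont by (intro continuous_AE_eq) auto
  qed
  show "0 \<le> hypoexp_density \<alpha> x" unfolding eq by (rule nonneg)
  show "\<exists>x. hypoexp_density \<alpha> x \<noteq> 0"
  proof (rule ccontr)
    assume "\<not> ?thesis"
    then have "distributed P lborel (\<lambda>X. \<Sum>j\<in>UNIV. \<alpha> $ j * X j) (\<lambda>x. 0)" using dist eq by simp
    then have "distr P lborel (\<lambda>X. \<Sum>j\<in>UNIV. \<alpha> $ j * X j) = density lborel (\<lambda>x. 0)"
      and rv: "(\<lambda>X. \<Sum>j\<in>UNIV. \<alpha> $ j * X j) \<in> P \<rightarrow>\<^sub>M lborel"
      by (simp_all add: distributed_def)
    moreover have "prob_space (distr P lborel (\<lambda>X. \<Sum>j\<in>UNIV. \<alpha> $ j * X j))"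
      using rv by (rule prob_space_distr)
    ultimately have "prob_space (density lborel (\<lambda>x::real. 0))" by simp
    then show False using prob_space.emeasure_space_1 by (force simp: emeasure_density)
  qed
qed

section \<open>Polynomials of exponential sums\<close>

text \<open>Words instead of multisets of letters: a power of a sum becomes a plain sum over
  functions, without multinomial coefficients. Lengths with zero coefficient are left out so that
  non-zero letters give non-zero weights.\<close>

definition words :: "real poly \<Rightarrow> (nat \<times> (nat \<Rightarrow> 'i::finite)) set" where
  "words p = (SIGMA k:{k. k \<le> degree p \<and> coeff p k \<noteq> 0}. {..<k} \<rightarrow>\<^sub>E UNIV)"

definition word_exponent :: "('i \<Rightarrow> real) \<Rightarrow> nat \<times> (nat \<Rightarrow> 'i) \<Rightarrow> real" where
  "word_exponent \<beta> v = (\<Sum>i<fst v. \<beta> (snd v i))"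

definition word_weight :: "real poly \<Rightarrow> ('i \<Rightarrow> real) \<Rightarrow> nat \<times> (nat \<Rightarrow> 'i) \<Rightarrow> real" where
  "word_weight p c v = coeff p (fst v) * (\<Prod>i<fst v. c (snd v i))"

definition poly_exponents :: "real poly \<Rightarrow> ('i::finite \<Rightarrow> real) \<Rightarrow> real set" where
  "poly_exponents p \<beta> = word_exponent \<beta> ` words p"

definition poly_weight :: "real poly \<Rightarrow> ('i::finite \<Rightarrow> real) \<Rightarrow> ('i \<Rightarrow> real) \<Rightarrow> real \<Rightarrow> real" where
  "poly_weight p \<beta> c \<gamma> = (\<Sum>v\<in>{v. v \<in> words p \<and> word_exponent \<beta> v = \<gamma>}. word_weight p c v)"

lemma finite_words: "finite (words p)"
  unfolding words_def by (intro finite_SigmaI finite_PiE) auto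

lemma finite_poly_exponents: "finite (poly_exponents p \<beta>)"
  unfolding poly_exponents_def by (intro finite_imageI finite_words)

text \<open>Stated over an arbitrary commutative ring, to be used both for functions and for their formal
  Taylor series.\<close>

lemma poly_exponential_expansion:
  fixes \<phi> :: "real \<Rightarrow> 'a::comm_ring_1" and e :: "real \<Rightarrow> 'a" and \<beta> c :: "'i::finite \<Rightarrow> real"
  assumes \<phi>: "\<And>a b. \<phi> (a + b) = \<phi> a + \<phi> b" "\<And>a b. \<phi> (a * b) = \<phi> a * \<phi> b" "\<phi> 0 = 0" "\<phi> 1 = 1"
    and e: "\<And>a b. e (a + b) = e a * e b" "e 0 = 1"
  shows "(\<Sum>k\<le>degree p. \<phi> (coeff p k) * (\<Sum>j\<in>UNIV. \<phi> (c j) * e (\<beta> j)) ^ k) =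
    (\<Sum>\<gamma>\<in>poly_exponents p \<beta>. \<phi> (poly_weight p \<beta> c \<gamma>) * e \<gamma>)"
proof -
  have \<phi>_sum: "\<phi> (sum g A) = (\<Sum>x\<in>A. \<phi> (g x))" for g :: "'b \<Rightarrow> real" and A
    by (induction A rule: infinite_finite_induct) (simp_all add: \<phi>)
  have \<phi>_prod: "\<phi> (\<Prod>i<k. g i) = (\<Prod>i<k. \<phi> (g i))" for g :: "nat \<Rightarrow> real" and k
    by (induction k) (simp_all add: \<phi>)
  have e_sum: "e (\<Sum>i<k. g i) = (\<Prod>i<k. e (g i))" for g :: "nat \<Rightarrow> real" and k
    by (induction k) (simp_all add: e)
  have power: "(\<Sum>j\<in>UNIV. \<phi> (c j) * e (\<beta> j)) ^ k =
      (\<Sum>w\<in>{..<k} \<rightarrow>\<^sub>E UNIV. (\<Prod>i<k. \<phi> (c (w i)) * e (\<beta> (w i))))" for k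
    using prod_sum_PiE[of "{..<k}" "\<lambda>_. UNIV" "\<lambda>_ j. \<phi> (c j) * e (\<beta> j)"] by simp
  have "(\<Sum>k\<le>degree p. \<phi> (coeff p k) * (\<Sum>j\<in>UNIV. \<phi> (c j) * e (\<beta> j)) ^ k) =
      (\<Sum>k\<in>{k. k \<le> degree p \<and> coeff p k \<noteq> 0}. \<phi> (coeff p k) * (\<Sum>j\<in>UNIV. \<phi> (c j) * e (\<beta> j)) ^ k)"
    by (intro sum.mono_neutral_right) (auto simp: \<phi>)
  also have "\<dots> = (\<Sum>k\<in>{k. k \<le> degree p \<and> coeff p k \<noteq> 0}. \<Sum>w\<in>{..<k} \<rightarrow>\<^sub>E UNIV.
      \<phi> (word_weight p c (k, w)) * e (word_exponent \<beta> (k, w)))"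
    by (simp add: power word_weight_def word_exponent_def \<phi>(2) \<phi>_prod e_sum prod.distrib sum_distrib_left mult.assoc)
  also have "\<dots> = (\<Sum>v\<in>words p. \<phi> (word_weight p c v) * e (word_exponent \<beta> v))"
    unfolding words_def by (subst sum.Sigma) (auto intro!: finite_PiE)
  also have "\<dots> = (\<Sum>\<gamma>\<in>poly_exponents p \<beta>. \<Sum>v\<in>{v. v \<in> words p \<and> word_exponent \<beta> v = \<gamma>}.
      \<phi> (word_weight p c v) * e (word_exponent \<beta> v))"
    unfolding poly_exponents_def by (rule sum.image_gen[OF finite_words])
  also have "\<dots> = (\<Sum>\<gamma>\<in>poly_exponents p \<beta>. \<phi> (poly_weight p \<beta> c \<gamma>) * e \<gamma>)"
    by (simp add: poly_weight_def \<phi>_sum sum_distrib_right)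
  finally show ?thesis .
qed

text \<open>The exponent of a multiset of letters; its injectivity is the form in which genericity
  of the rates is used.\<close>

definition multi_exponent :: "('i::finite \<Rightarrow> real) \<Rightarrow> ('i \<Rightarrow> nat) \<Rightarrow> real" where
  "multi_exponent \<beta> n = (\<Sum>j\<in>UNIV. real (n j) * \<beta> j)"

text \<open>Words with the same exponent are rearrangements of one another, so they share their
  weight, and the sum is their number times a non-zero term.\<close>

lemma poly_weight_neq_0:
  fixes \<beta> c :: "'i::finite \<Rightarrow> real"
  assumes inj: "inj (multi_exponent \<beta>)" and c: "\<And>j. c j \<noteq> 0" and \<gamma>: "\<gamma> \<in> poly_exponents p \<beta>"
  shows "poly_weight p \<beta> c \<gamma> \<noteq> 0"
proof -
  define n where "n v j = card {i \<in> {..<fst v}. snd v i = j}" for v :: "nat \<times> (nat \<Rightarrow> 'i)" and j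
  have exponent: "word_exponent \<beta> v = multi_exponent \<beta> (n v)" for v
  proof -
    have "word_exponent \<beta> v = (\<Sum>j\<in>UNIV. \<Sum>i\<in>{i \<in> {..<fst v}. snd v i = j}. \<beta> (snd v i))"
      unfolding word_exponent_def by (rule sum.group[symmetric]) auto
    also have "\<dots> = multi_exponent \<beta> (n v)"
      unfolding multi_exponent_def n_def by (intro sum.cong refl) simp
    finally show ?thesis .
  qed
  have len: "fst v = (\<Sum>j\<in>UNIV. n v j)" for v
  proof -
    have "(\<Sum>j\<in>UNIV. \<Sum>i\<in>{i \<in> {..<fst v}. snd v i = j}. 1::nat) = (\<Sum>i<fst v. 1)"
      by (rule sum.group) auto
    then show ?thesis by (simp add: n_def)
  qed
  have weight: "word_weight p c v = coeff p (\<Sum>j\<in>UNIV. n v j) * (\<Prod>j\<in>UNIV. c j ^ n v j)" for v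
  proof -
    have "(\<Prod>i<fst v. c (snd v i)) = (\<Prod>j\<in>UNIV. \<Prod>i\<in>{i \<in> {..<fst v}. snd v i = j}. c (snd v i))"
      by (rule prod.group[symmetric]) auto
    also have "\<dots> = (\<Prod>j\<in>UNIV. c j ^ n v j)"
      unfolding n_def by (intro prod.cong refl) simp
    finally show ?thesis by (simp add: word_weight_def flip: len)
  qed
  define V where "V = {v. v \<in> words p \<and> word_exponent \<beta> v = \<gamma>}"
  obtain u where u: "u \<in> V" using \<gamma> by (auto simp: poly_exponents_def V_def)
  have "n v = n u" if "v \<in> V" for v
    using that u inj by (auto simp: V_def exponent dest: injD)
  then have "poly_weight p \<beta> c \<gamma> = (\<Sum>v\<in>V. word_weight p c u)"
    unfolding poly_weight_def V_def[symmetric] by (intro sum.cong) (simp_all add: weight)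
  also have "\<dots> = card V * word_weight p c u" by simp
  finally have eq: "poly_weight p \<beta> c \<gamma> = card V * word_weight p c u" .
  have "finite V" unfolding V_def using finite_words[of p] by (rule rev_finite_subset) auto
  then have "card V \<noteq> 0" using u by auto
  moreover have "word_weight p c u \<noteq> 0"
    using u c by (auto simp: V_def words_def word_weight_def)
  ultimately show ?thesis using eq by simp
qed

lemma word_exponent_in_poly_exponents:
  assumes "k \<le> degree p" "coeff p k \<noteq> 0"
  shows "(\<Sum>i<k. \<beta> (w i)) \<in> poly_exponents p \<beta>"
proof -
  have "(k, restrict w {..<k}) \<in> words p" using assms by (auto simp: words_def)
  then have "word_exponent \<beta> (k, restrict w {..<k}) \<in> poly_exponents p \<beta>"
    unfolding poly_exponents_def by (rule imageI)
  then show ?thesis by (simp add: word_exponent_def)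
qed

text \<open>Multisets of \<open>d\<close> letters suffice: \<open>d\<close> copies of
  \<open>a\<close>; at least one copy of another letter, filled up with \<open>a\<close>; and one
  containing both \<open>b\<close> and \<open>c\<close>. The last needs three letters and pushes the
  count beyond 1 + d (m - 1).\<close>

lemma card_poly_exponents_ge:
  fixes \<beta> :: "'i::finite \<Rightarrow> real"
  assumes card: "3 \<le> CARD('i)" and inj: "inj (multi_exponent \<beta>)"
    and d: "d = degree p" "2 \<le> d"
  shows "d * (CARD('i) - 1) + 2 \<le> card (poly_exponents p \<beta>)"
proof -
  obtain T :: "'i set" where "card T = 3" using card by (meson obtain_subset_with_card_n)
  then obtain a b c :: 'i where abc: "a \<noteq> b" "b \<noteq> c" "a \<noteq> c" by (auto simp: card_3_iff)
  define mono where "mono = (\<lambda>(j, i) t. if t = j then i else if t = a then d - i else (0::nat))"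
  define base where "base = (\<lambda>t. if t = a then d else (0::nat))"
  define mixed where "mixed = (\<lambda>t. if t = a then d - 2 else if t = b \<or> t = c then 1 else (0::nat))"
  define I where "I = (- {a}) \<times> {1..d}"
  define A where "A = insert base (insert mixed (mono ` I))"
  have lead: "coeff p d \<noteq> 0" using d by auto
  have exponent: "multi_exponent \<beta> n = n a * \<beta> a + (\<Sum>j\<in>-{a}. n j * \<beta> j)" for n
    unfolding multi_exponent_def by (subst sum.remove[of _ a]) (simp_all add: Compl_eq_Diff_UNIV)
  have "inj_on mono I"
  proof (rule inj_onI)
    fix u v assume uv: "u \<in> I" "v \<in> I" "mono u = mono v"
    obtain j i j' i' where [simp]: "u = (j, i)" "v = (j', i')" by (cases u, cases v)
    have "mono u j = mono v j" using uv by simp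
    then show "u = v" using uv(1,2) by (auto simp: mono_def I_def split: if_splits)
  qed
  then have "card (mono ` I) = (CARD('i) - 1) * d"
    by (simp add: card_image I_def card_cartesian_product Compl_eq_Diff_UNIV)
  moreover have "mixed \<notin> mono ` I"
  proof
    assume "mixed \<in> mono ` I"
    then obtain j i where ji: "j \<noteq> a" "mixed = mono (j, i)" by (auto simp: I_def)
    have "mixed b = 1" "mixed c = 1" using abc by (auto simp: mixed_def)
    then have "mono (j, i) b \<noteq> 0" "mono (j, i) c \<noteq> 0" using ji by simp_all
    then show False using abc ji(1) by (auto simp: mono_def split: if_splits)
  qed
  moreover have "base \<notin> insert mixed (mono ` I)"
  proof
    assume "base \<in> insert mixed (mono ` I)"
    then show False
    proof (elim insertE imageE)
      assume "base = mixed"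
      then have "base b = mixed b" by simp
      then show False using abc by (simp add: base_def mixed_def)
    next
      fix u assume u: "base = mono u" "u \<in> I"
      then have ji: "fst u \<noteq> a" "snd u \<noteq> 0" by (auto simp: I_def)
      have "base (fst u) = mono u (fst u)" using u(1) by simp
      then show False using ji by (simp add: base_def mono_def split_beta)
    qed
  qed
  ultimately have cardA: "card A = d * (CARD('i) - 1) + 2"
    by (simp add: A_def I_def)
  have "multi_exponent \<beta> ` A \<subseteq> poly_exponents p \<beta>"
  proof
    fix s assume "s \<in> multi_exponent \<beta> ` A"
    then obtain n where n: "n \<in> A" "s = multi_exponent \<beta> n" by blast
    consider "n = base" | "n = mixed" | u where "u \<in> I" "n = mono u"
      using n(1) unfolding A_def by blast
    then show "s \<in> poly_exponents p \<beta>"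
    proof cases
      case 1
      have "s = (\<Sum>i<d. \<beta> a)" by (simp add: n(2) 1 exponent base_def)
      then show ?thesis using word_exponent_in_poly_exponents[of d p \<beta> "\<lambda>_. a"] d lead by simp
    next
      case 2
      define w where "w i = (if i = 0 then b else if i = 1 then c else a)" for i :: nat
      define r where "r = d - 2"
      have r: "d = Suc (Suc r)" using d(2) unfolding r_def by arith
      have "(\<Sum>j\<in>-{a}. mixed j * \<beta> j) = (\<Sum>j\<in>{b, c}. mixed j * \<beta> j)"
        using abc by (intro sum.mono_neutral_right) (auto simp: mixed_def)
      then have "s = real r * \<beta> a + (\<beta> b + \<beta> c)"
        using abc by (simp add: n(2) 2 exponent mixed_def r_def)
      also have "\<dots> = (\<Sum>i<d. \<beta> (w i))"
        unfolding r sum.lessThan_Suc_shift by (simp add: w_def)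
      finally have "s = (\<Sum>i<d. \<beta> (w i))" .
      then show ?thesis using word_exponent_in_poly_exponents[of d p \<beta> w] d lead by simp
    next
      case 3
      obtain j i where ji: "u = (j, i)" by (cases u)
      then have j: "j \<noteq> a" and i: "i \<le> d" using 3(1) by (simp_all add: I_def)
      define w where "w l = (if l < i then j else a)" for l
      have "(\<Sum>t\<in>-{a}. mono (j, i) t * \<beta> t) = (\<Sum>t\<in>{j}. mono (j, i) t * \<beta> t)"
        using j by (intro sum.mono_neutral_right) (auto simp: mono_def)
      then have s: "s = i * \<beta> j + real (d - i) * \<beta> a" using j by (simp add: n(2) 3(2) ji exponent mono_def)
      have split: "{..<d} = {..<i} \<union> {i..<d}" using i by auto
      have "(\<Sum>l<d. \<beta> (w l)) = (\<Sum>l<i. \<beta> (w l)) + (\<Sum>l\<in>{i..<d}. \<beta> (w l))"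
        unfolding split by (rule sum.union_disjoint) auto
      also have "(\<Sum>l<i. \<beta> (w l)) = (\<Sum>l<i. \<beta> j)"
        by (intro sum.cong) (simp_all add: w_def)
      also have "(\<Sum>l\<in>{i..<d}. \<beta> (w l)) = (\<Sum>l\<in>{i..<d}. \<beta> a)"
        by (intro sum.cong) (simp_all add: w_def)
      also have "(\<Sum>l<i. \<beta> j) + (\<Sum>l\<in>{i..<d}. \<beta> a) = s"
        using i by (simp add: s)
      finally show ?thesis using word_exponent_in_poly_exponents[of d p \<beta> w] d lead by simp
    qed
  qed
  then have "card (multi_exponent \<beta> ` A) \<le> card (poly_exponents p \<beta>)"
    by (intro card_mono finite_poly_exponents)
  moreover have "card (multi_exponent \<beta> ` A) = card A"
    by (rule card_image[OF inj_on_subset[OF inj subset_UNIV]])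
  ultimately show ?thesis using cardA by simp
qed

lemma poly_exponents_pos:
  assumes "\<And>j. 0 < \<beta> j" "coeff p 0 = 0" "\<gamma> \<in> poly_exponents p \<beta>"
  shows "0 < \<gamma>"
proof -
  obtain k w where kw: "coeff p k \<noteq> 0" "\<gamma> = (\<Sum>i<k. \<beta> (w i))"
    using assms(3) by (auto simp: poly_exponents_def words_def word_exponent_def)
  then have "k \<noteq> 0" using assms(2) by metis
  then show ?thesis unfolding kw(2) using assms(1) by (intro sum_pos) auto
qed

lemma poly_hypo_exp_sum:
  fixes \<beta> :: "'i::finite \<Rightarrow> real"
  assumes "coeff p 0 = 0"
  shows "poly p (hypo_exp_sum \<beta> UNIV x) =
    exp_sum (poly_exponents p \<beta>) (poly_weight p \<beta> (hypo_coeff \<beta> UNIV)) x"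
proof (cases "x < 0")
  case True
  then show ?thesis using assms by (simp add: hypo_exp_sum_def exp_sum_def poly_0_coeff_0)
next
  case False
  have "poly p (hypo_exp_sum \<beta> UNIV x) =
      (\<Sum>k\<le>degree p. coeff p k * (\<Sum>j\<in>UNIV. hypo_coeff \<beta> UNIV j * exp (- \<beta> j * x)) ^ k)"
    using False by (simp add: poly_altdef hypo_exp_sum_def)
  also have "\<dots> = (\<Sum>\<gamma>\<in>poly_exponents p \<beta>. poly_weight p \<beta> (hypo_coeff \<beta> UNIV) \<gamma> * exp (- \<gamma> * x))"
    by (rule poly_exponential_expansion[where \<phi> = "\<lambda>a. a" and e = "\<lambda>\<gamma>. exp (- \<gamma> * x)"])
       (simp_all add: algebra_simps flip: exp_add)
  finally show ?thesis using False by (simp add: exp_sum_def)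
qed

section \<open>Order of vanishing at 0\<close>

text \<open>The lowest power of \<open>L\<close> present in \<open>p\<close> decides the order: as
  \<open>L\<close> has no constant term, higher powers start later.\<close>

lemma fps_poly_subdegree:
  fixes L :: "real fps"
  assumes L: "L \<noteq> 0" "fps_nth L 0 = 0" and p: "p \<noteq> 0"
  obtains r where "r \<le> degree p"
    "fps_nth (\<Sum>k\<le>degree p. fps_const (coeff p k) * L ^ k) (r * subdegree L) \<noteq> 0"
proof -
  define r where "r = (LEAST k. coeff p k \<noteq> 0)"
  have "lead_coeff p \<noteq> 0" using p by simp
  then have r: "coeff p r \<noteq> 0" unfolding r_def by (rule LeastI)
  then have r_le: "r \<le> degree p" by (rule le_degree)
  have "subdegree L \<noteq> 0" using L subdegree_eq_0_iff by blast
  then have \<sigma>: "0 < subdegree L" by simp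
  have other: "fps_nth (fps_const (coeff p k) * L ^ k) (r * subdegree L) = 0" if "k \<noteq> r" for k
  proof (cases "k < r")
    case True
    then have "coeff p k = 0" unfolding r_def using not_less_Least by blast
    then show ?thesis by simp
  next
    case False
    then have "r * subdegree L < subdegree (L ^ k)" using that \<sigma> by simp
    then have "fps_nth (L ^ k) (r * subdegree L) = 0" by (rule nth_less_subdegree_zero)
    then show ?thesis by simp
  qed
  have "fps_nth (\<Sum>k\<le>degree p. fps_const (coeff p k) * L ^ k) (r * subdegree L) =
      (\<Sum>k\<in>{r}. fps_nth (fps_const (coeff p k) * L ^ k) (r * subdegree L))"
    unfolding fps_sum_nth using r_le other by (intro sum.mono_neutral_right) auto
  also have "\<dots> = coeff p r * fps_nth (L ^ r) (subdegree (L ^ r))" by simp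
  also have "\<dots> \<noteq> 0"
    using r L(1) nth_subdegree_nonzero[of "L ^ r"] by (simp del: subdegree_power)
  finally show ?thesis using that r_le by blast
qed

text \<open>A Vandermonde argument: were all these moments zero, so would be the pairing with every
  polynomial of degree below \<open>CARD('i)\<close>, but \<open>q\<close> vanishes at all nodes
  except one.\<close>

lemma exp_sum_moment_neq_0:
  fixes \<beta> c :: "'i::finite \<Rightarrow> real"
  assumes inj: "inj \<beta>" and c: "\<And>j. c j \<noteq> 0"
  obtains t where "t < CARD('i)" "(\<Sum>j\<in>UNIV. c j * (- \<beta> j) ^ t) \<noteq> 0"
proof -
  obtain k :: 'i where True by blast
  define q where "q = (\<Prod>i\<in>UNIV - {k}. [:\<beta> i, 1:])"
  have deg: "degree q = CARD('i) - 1" unfolding q_def by (subst degree_prod_sum_eq) auto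
  have "(\<Sum>j\<in>UNIV. c j * poly q (- \<beta> j)) = (\<Sum>j\<in>{k}. c j * poly q (- \<beta> j))"
    unfolding q_def poly_prod by (intro sum.mono_neutral_right) (auto intro!: prod_zero)
  also have "\<dots> \<noteq> 0"
    using c[of k] inj by (auto simp: q_def poly_prod dest: injD)
  finally have "(\<Sum>j\<in>UNIV. c j * poly q (- \<beta> j)) \<noteq> 0" .
  also have "(\<Sum>j\<in>UNIV. c j * poly q (- \<beta> j)) = (\<Sum>t\<le>degree q. coeff q t * (\<Sum>j\<in>UNIV. c j * (- \<beta> j) ^ t))"
    unfolding poly_altdef sum_distrib_left by (subst sum.swap) (simp add: mult_ac)
  finally obtain t where t: "t \<le> degree q" "(\<Sum>j\<in>UNIV. c j * (- \<beta> j) ^ t) \<noteq> 0"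
    by (metis (no_types, lifting) atMost_iff mult_eq_0_iff sum.neutral)
  have "0 < CARD('i)" by simp
  then have "t < CARD('i)" using t(1) deg by linarith
  then show ?thesis using that t(2) by blast
qed

text \<open>Near \<open>0\<close> the composition vanishes to order at most \<open>degree p * (CARD('i) - 1)\<close>, fewer than its
  number of exponentials would require.\<close>

lemma not_totally_nonneg_poly_hypo_exp_sum:
  fixes \<beta> :: "'i::finite \<Rightarrow> real"
  assumes card: "3 \<le> CARD('i)" and pos: "\<And>j. 0 < \<beta> j" and inj: "inj (multi_exponent \<beta>)" "inj \<beta>"
    and p: "2 \<le> degree p" "coeff p 0 = 0" and nz: "poly p (hypo_exp_sum \<beta> UNIV x0) \<noteq> 0"
  shows "\<not> totally_nonneg (\<lambda>x. poly p (hypo_exp_sum \<beta> UNIV x))"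
proof
  define c where "c = hypo_coeff \<beta> UNIV"
  define \<Gamma> where "\<Gamma> = poly_exponents p \<beta>"
  define C where "C = poly_weight p \<beta> c"
  have f: "poly p (hypo_exp_sum \<beta> UNIV x) = exp_sum \<Gamma> C x" for x
    unfolding \<Gamma>_def C_def c_def using p(2) by (rule poly_hypo_exp_sum)
  assume "totally_nonneg (\<lambda>x. poly p (hypo_exp_sum \<beta> UNIV x))"
  then have tn: "totally_nonneg (exp_sum \<Gamma> C)" unfolding f by simp
  have c: "c j \<noteq> 0" for j unfolding c_def by (rule hypo_coeff_neq_0) (simp_all add: inj pos)
  have \<Gamma>: "finite \<Gamma>" "\<And>\<gamma>. \<gamma> \<in> \<Gamma> \<Longrightarrow> 0 < \<gamma>" "\<And>\<gamma>. \<gamma> \<in> \<Gamma> \<Longrightarrow> C \<gamma> \<noteq> 0"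
    using finite_poly_exponents poly_exponents_pos[OF pos p(2)] poly_weight_neq_0[OF inj(1) c]
    by (auto simp: \<Gamma>_def C_def)
  have "degree (numer_poly \<Gamma> C) = 0"
    using \<Gamma> tn nz unfolding f by (rule degree_numer_poly_of_totally_nonneg)
  \<comment> \<open>The moments are the right-hand derivatives of the composition at 0.\<close>
  then have moments: "(\<Sum>\<gamma>\<in>\<Gamma>. C \<gamma> * (- \<gamma>) ^ k) = 0" if "Suc k < card \<Gamma>" for k
    using moments_zero_of_numer_poly_const[OF \<Gamma>(1)] that by blast
  \<comment> \<open>The Taylor series at 0 of the exponential sum that gives the density on the
    half-line.\<close>
  define L where "L = (\<Sum>j\<in>UNIV. fps_const (c j) * fps_exp (- \<beta> j))"
  have L_nth: "fps_nth L k = (\<Sum>j\<in>UNIV. c j * (- \<beta> j) ^ k) / fact k" for k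
    by (simp add: L_def fps_sum_nth sum_divide_distrib)
  obtain t where t: "t < CARD('i)" "fps_nth L t \<noteq> 0"
    using exp_sum_moment_neq_0[of \<beta> c] inj c unfolding L_nth by auto
  then have L: "L \<noteq> 0" by auto
  have "subdegree L \<le> t" using t(2) by (rule subdegree_leI)
  then have subdeg: "subdegree L \<le> CARD('i) - 1" using t(1) by simp
  have L0: "fps_nth L 0 = 0"
    using sum_hypo_coeff_eq_0[of UNIV \<beta>] card inj by (simp add: L_nth c_def)
  have "p \<noteq> 0" using p by auto
  then obtain r where r: "r \<le> degree p"
    "fps_nth (\<Sum>k\<le>degree p. fps_const (coeff p k) * L ^ k) (r * subdegree L) \<noteq> 0"
    using fps_poly_subdegree[OF L L0] by blast
  have "(\<Sum>k\<le>degree p. fps_const (coeff p k) * L ^ k) = (\<Sum>\<gamma>\<in>\<Gamma>. fps_const (C \<gamma>) * fps_exp (- \<gamma>))"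
    unfolding L_def \<Gamma>_def C_def
    by (rule poly_exponential_expansion[where \<phi> = fps_const and e = "\<lambda>\<gamma>. fps_exp (- \<gamma>)"])
       (simp_all flip: fps_exp_add_mult)
  then have "fps_nth (\<Sum>\<gamma>\<in>\<Gamma>. fps_const (C \<gamma>) * fps_exp (- \<gamma>)) (r * subdegree L) \<noteq> 0"
    using r(2) by simp
  moreover have "r * subdegree L \<le> degree p * (CARD('i) - 1)"
    using r(1) subdeg by (rule mult_le_mono)
  then have "Suc (r * subdegree L) < card \<Gamma>"
    using card_poly_exponents_ge[OF card inj(1) refl p(1)] unfolding \<Gamma>_def by linarith
  then have "(\<Sum>\<gamma>\<in>\<Gamma>. C \<gamma> * (- \<gamma>) ^ (r * subdegree L)) / fact (r * subdegree L) = 0"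
    by (simp add: moments)
  ultimately show False by (simp add: fps_sum_nth sum_divide_distrib)
qed

section \<open>The exceptional set and the theorem\<close>

text \<open>The minor with rows u < v + t and columns 0 < t.\<close>

lemma totally_nonneg_2x2:
  assumes "totally_nonneg f" "0 < t" "u < v + t"
  shows "f (u - t) * f (v + t) \<le> f u * f v"
proof -
  define x y where "x = (\<lambda>i::nat. if i = 0 then u else v + t)" and "y = (\<lambda>j::nat. if j = 0 then 0 else t)"
  define M where "M = Matrix.mat 2 2 (\<lambda>(i, j). f (x i - y j))"
  have M: "M \<in> carrier_mat 2 2" by (simp add: M_def)
  have "0 \<le> Determinant.det M"
    unfolding M_def using assms(2,3)
    by (intro assms(1)[unfolded totally_nonneg_def, rule_format])
       (auto simp: strict_mono_on_def x_def y_def)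
  also have "Determinant.det M = (\<Sum>i<2. M $$ (i, 0) * cofactor M i 0)"
    by (rule laplace_expansion_column[OF M]) simp
  also have "\<dots> = M $$ (0, 0) * M $$ (1, 1) - M $$ (1, 0) * M $$ (0, 1)"
  proof -
    have "cofactor M 0 0 = M $$ (1, 1)" "cofactor M 1 0 = - M $$ (0, 1)"
      using M by (simp_all add: cofactor_def mat_delete_def det_single)
    then show ?thesis by (simp add: numeral_2_eq_2)
  qed
  also have "\<dots> = f u * f v - f (v + t) * f (u - t)"
    by (simp add: M_def x_def y_def)
  finally show ?thesis by (simp add: mult.commute)
qed

lemma totally_nonneg_same_limits_const:
  assumes tn: "totally_nonneg f" and left: "\<And>x. x < 0 \<Longrightarrow> f x = a" and lim: "(f \<longlongrightarrow> a) at_top" and a: "0 < a"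
  shows "f x = a"
proof -
  have mono: "f w \<le> f v" if "w < v" for w v
  proof -
    have shift: "filterlim (\<lambda>t. s + t) at_top at_top" for s :: real
      by (rule filterlim_tendsto_add_at_top[OF tendsto_const filterlim_ident])
    \<comment> \<open>The minor inequality is used with \<open>u = t + w\<close>; as
      \<open>t\<close> grows, the values far to the right become \<open>a\<close>.\<close>
    have "f w * a \<le> a * f v"
    proof (rule tendsto_le)
      show "((\<lambda>t. f w * f (v + t)) \<longlongrightarrow> f w * a) at_top"
        by (intro tendsto_intros filterlim_compose[OF lim shift])
      show "((\<lambda>t. f (w + t) * f v) \<longlongrightarrow> a * f v) at_top"
        by (intro tendsto_intros filterlim_compose[OF lim shift])
      show "\<forall>\<^sub>F t in at_top. f w * f (v + t) \<le> f (w + t) * f v"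
        using eventually_gt_at_top[of "0::real"]
      proof eventually_elim
        case (elim t)
        then show ?case using totally_nonneg_2x2[OF tn, of t "w + t" v] that by simp
      qed
    qed simp
    then show ?thesis using a by (simp add: mult.commute)
  qed
  have "f x \<le> a"
  proof (rule tendsto_lowerbound[OF lim])
    show "\<forall>\<^sub>F y in at_top. f x \<le> f y"
      using eventually_gt_at_top[of x] by eventually_elim (rule mono)
  qed simp
  moreover have "a \<le> f x"
  proof -
    define w where "w = min x 0 - 1"
    have "w < 0" "w < x" by (simp_all add: w_def)
    then show ?thesis using mono[of w x] left[of w] by simp
  qed
  ultimately show ?thesis by simp
qed

lemma hypo_exp_sum_tendsto_0:
  assumes "finite J" "\<And>j. j \<in> J \<Longrightarrow> 0 < \<beta> j"
  shows "(hypo_exp_sum \<beta> J \<longlongrightarrow> 0) at_top"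
proof -
  have "((\<lambda>x. exp (- \<beta> j * x) * poly 1 (0 - x)) \<longlongrightarrow> 0) at_top" if "j \<in> J" for j
    by (rule tendsto_poly_exp_0[OF assms(2)[OF that]])
  then have "((\<lambda>x. \<Sum>j\<in>J. hypo_coeff \<beta> J j * exp (- \<beta> j * x)) \<longlongrightarrow> (\<Sum>j\<in>J. hypo_coeff \<beta> J j * 0)) at_top"
    by (intro tendsto_sum tendsto_mult tendsto_const) simp
  moreover have "\<forall>\<^sub>F x in at_top. (\<Sum>j\<in>J. hypo_coeff \<beta> J j * exp (- \<beta> j * x)) = hypo_exp_sum \<beta> J x"
    using eventually_ge_at_top[of 0] by eventually_elim (simp add: hypo_exp_sum_def)
  ultimately show ?thesis by (simp add: tendsto_cong)
qed

text \<open>A connected range with two points is infinite, too large for the roots of a non-zero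
  polynomial.\<close>

lemma poly_const_of_comp_const:
  fixes \<Lambda> :: "real \<Rightarrow> real"
  assumes cont: "continuous_on UNIV \<Lambda>" and "\<Lambda> s \<noteq> \<Lambda> t" and const: "\<And>x. poly p (\<Lambda> x) = a"
  shows "p = [:a:]"
proof (rule ccontr)
  assume "p \<noteq> [:a:]"
  then have "finite {y. poly (p - [:a:]) y = 0}" by (intro poly_roots_finite) simp
  moreover have "range \<Lambda> \<subseteq> {y. poly (p - [:a:]) y = 0}" using const by auto
  ultimately have "finite (range \<Lambda>)" by (rule rev_finite_subset)
  moreover have "connected (range \<Lambda>)" using cont by (intro connected_continuous_image) auto
  ultimately obtain y where "range \<Lambda> \<subseteq> {y}"
    by (metis connected_finite_iff_sing empty_subsetI order_refl)
  then have "\<Lambda> s = y" "\<Lambda> t = y" by auto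
  then show False using assms(2) by simp
qed

lemma inj_of_inj_multi_exponent:
  assumes "inj (multi_exponent \<beta>)"
  shows "inj \<beta>"
proof (rule injI)
  fix i j assume eq: "\<beta> i = \<beta> j"
  define n where "n k = (\<lambda>l. if l = k then 1 else (0::nat))" for k :: 'a
  have "multi_exponent \<beta> (n k) = (\<Sum>l\<in>{k}. n k l * \<beta> l)" for k
    unfolding multi_exponent_def by (intro sum.mono_neutral_right) (auto simp: n_def)
  then have "multi_exponent \<beta> (n k) = \<beta> k" for k by (simp add: n_def)
  then have "n i = n j" using assms eq by (simp add: inj_eq[symmetric])
  then have "n i i = n j i" by simp
  then show "i = j" by (simp add: n_def split: if_splits)
qed

text \<open>In terms of the rates each integer relation is a hyperplane, and there are countably
  many. Coordinatewise inversion is an involution of the positive orthant and differentiable there,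
  so it carries these null sets to null sets of parameters.\<close>

lemma negligible_not_inj_multi_exponent:
  "negligible {\<alpha> :: real ^ 'm::finite. (\<forall>j. 0 < \<alpha> $ j) \<and> \<not> inj (multi_exponent (\<lambda>j. 1 / \<alpha> $ j))}"
proof -
  define f where "f = (\<lambda>x :: real ^ 'm. \<chi> j. inverse (x $ j))"
  define H where "H k = {x :: real ^ 'm. (\<chi> j. real_of_int (k j)) \<bullet> x = 0} \<inter> {x. \<forall>j. 0 < x $ j}" for k
  define K where "K = {k :: 'm \<Rightarrow> int. k \<noteq> (\<lambda>_. 0)}"
  have "negligible (f ` H k)" if k: "k \<in> K" for k
  proof (rule negligible_differentiable_image_negligible)
    obtain j where j: "k j \<noteq> 0" using k by (auto simp: K_def fun_eq_iff)
    have "(\<chi> j. real_of_int (k j)) \<noteq> (0 :: real ^ 'm)"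
    proof
      assume "(\<chi> j. real_of_int (k j)) = (0 :: real ^ 'm)"
      then have "(\<chi> j. real_of_int (k j)) $ j = (0 :: real ^ 'm) $ j" by (simp only:)
      then show False using j by simp
    qed
    then have "negligible {x :: real ^ 'm. (\<chi> j. real_of_int (k j)) \<bullet> x = 0}"
      by (intro negligible_hyperplane) simp
    then show "negligible (H k)" unfolding H_def by (rule negligible_subset) simp
    show "f differentiable_on H k"
      unfolding differentiable_on_def
    proof
      fix x assume "x \<in> H k"
      then have x: "x $ j \<noteq> 0" for j by (auto simp: H_def less_le)
      have "(\<lambda>y :: real ^ 'm. inverse (y $ j)) differentiable (at x within H k)" for j
        using Deriv.has_derivative_inverse[OF x[of j] bounded_linear_imp_has_derivative[OF bounded_linear_vec_nth]]
        by (rule differentiableI)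
      then show "f differentiable (at x within H k)"
        by (subst differentiable_componentwise_within) (auto simp: f_def Basis_vec_def inner_axis)
    qed
  qed simp
  then have "negligible (\<Union>k\<in>K. f ` H k)"
    by (intro negligible_countable_Union) auto
  then show ?thesis
  proof (rule negligible_subset, safe)
    fix \<alpha> :: "real ^ 'm"
    assume pos: "\<forall>j. 0 < \<alpha> $ j" and "\<not> inj (multi_exponent (\<lambda>j. 1 / \<alpha> $ j))"
    then obtain n n' where n: "n \<noteq> n'" "multi_exponent (\<lambda>j. 1 / \<alpha> $ j) n = multi_exponent (\<lambda>j. 1 / \<alpha> $ j) n'"
      by (auto simp: inj_def)
    define k where "k j = int (n j) - int (n' j)" for j
    have "k \<in> K" using n(1) by (auto simp: K_def k_def fun_eq_iff)
    moreover have "(\<chi> j. real_of_int (k j)) \<bullet> f \<alpha> = 0"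
      using n(2) by (simp add: inner_vec_def f_def k_def multi_exponent_def algebra_simps sum_subtractf divide_inverse)
    then have "f \<alpha> \<in> H k" using pos by (simp add: H_def f_def)
    moreover have "\<alpha> = f (f \<alpha>)" by (simp add: f_def vec_eq_iff)
    ultimately show "\<alpha> \<in> (\<Union>k\<in>K. f ` H k)" by blast
  qed
qed

theorem theorem4p4:
  assumes "CARD('m :: finite) \<ge> 3"
  shows "\<exists>N :: (real ^ 'm) set.
    N \<subseteq> {\<alpha>. \<forall>j. 0 < \<alpha> $ j} \<and> N \<in> null_sets lebesgue \<and>
    (\<forall>\<alpha> \<in> {\<alpha>. \<forall>j. 0 < \<alpha> $ j} - N. \<forall>p :: real poly. \<not> homothetic_poly p \<longrightarrow>
       ((\<nexists>c. 0 \<le> c \<and> p = [:c:]) \<longrightarrow> \<not> totally_nonneg (\<lambda>x. poly p (hypoexp_density \<alpha> x))) \<and>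
       \<not> polya_frequency_function (\<lambda>x. poly p (hypoexp_density \<alpha> x)))"
proof (intro exI conjI ballI allI impI)
  let ?N = "{\<alpha> :: real ^ 'm. (\<forall>j. 0 < \<alpha> $ j) \<and> \<not> inj (multi_exponent (\<lambda>j. 1 / \<alpha> $ j))}"
  show "?N \<subseteq> {\<alpha>. \<forall>j. 0 < \<alpha> $ j}" by blast
  show "?N \<in> null_sets lebesgue"
    using negligible_not_inj_multi_exponent by (simp add: negligible_iff_null_sets)
  fix \<alpha> :: "real ^ 'm" and p :: "real poly"
  assume \<alpha>: "\<alpha> \<in> {\<alpha>. \<forall>j. 0 < \<alpha> $ j} - ?N" and hom: "\<not> homothetic_poly p"
  define \<beta> where "\<beta> = (\<lambda>j. 1 / \<alpha> $ j)"
  have \<alpha>_pos: "0 < \<alpha> $ j" and \<beta>_pos: "0 < \<beta> j" for j using \<alpha> by (auto simp: \<beta>_def)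
  have inj: "inj (multi_exponent \<beta>)" using \<alpha> by (auto simp: \<beta>_def)
  then have inj\<beta>: "inj \<beta>" by (rule inj_of_inj_multi_exponent)
  define \<Lambda> where "\<Lambda> = hypoexp_density \<alpha>"
  have "2 \<le> CARD('m)" using assms by simp
  note density = hypoexp_density_eq[OF \<alpha>_pos inj\<beta>[unfolded \<beta>_def] this, folded \<beta>_def \<Lambda>_def]
  have \<Lambda>: "\<Lambda> = hypo_exp_sum \<beta> UNIV" by (rule density(1))
  obtain x1 where x1: "\<Lambda> x1 \<noteq> 0" using density(3) by blast
  then have \<Lambda>x1: "0 < \<Lambda> x1" using density(2)[of x1] by simp
  have \<Lambda>_neg: "\<Lambda> x = 0" if "x < 0" for x using that by (simp add: \<Lambda> hypo_exp_sum_def)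
  have cont: "continuous_on UNIV \<Lambda>"
    unfolding \<Lambda> using assms inj\<beta> by (intro continuous_hypo_exp_sum) simp_all
  have const: "p = [:a:]" if "\<And>x. poly p (\<Lambda> x) = a" for a
    using x1 \<Lambda>_neg[of "-1"] that by (intro poly_const_of_comp_const[OF cont, of x1 "-1"]) simp_all
  show not_tn: "\<not> totally_nonneg (\<lambda>x. poly p (hypoexp_density \<alpha> x))" if nonconst: "\<nexists>c. 0 \<le> c \<and> p = [:c:]"
  proof
    assume "totally_nonneg (\<lambda>x. poly p (hypoexp_density \<alpha> x))"
    then have tn: "totally_nonneg (\<lambda>x. poly p (\<Lambda> x))" by (simp add: \<Lambda>_def)
    define a where "a = poly p 0"
    have "0 \<le> poly p (\<Lambda> (-1))" using tn by (rule totally_nonneg_nonneg)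
    then have "0 \<le> a" using \<Lambda>_neg[of "-1"] by (simp add: a_def)
    then consider "0 < a" | "a = 0" "degree p \<le> 1" | "a = 0" "2 \<le> degree p" by linarith
    then show False
    proof cases
      \<comment> \<open>The density is 0 on the negative half-line and tends to 0 at infinity, so
        the composition has the value, respectively the limit, \<open>a\<close>.\<close>
      case 1
      have "isCont (poly p) 0" by simp
      moreover have "(\<Lambda> \<longlongrightarrow> 0) at_top"
        unfolding \<Lambda> by (rule hypo_exp_sum_tendsto_0) (simp_all add: \<beta>_pos)
      ultimately have "((\<lambda>x. poly p (\<Lambda> x)) \<longlongrightarrow> a) at_top"
        unfolding a_def by (rule isCont_tendsto_compose)
      then have "poly p (\<Lambda> x) = a" for x
        using totally_nonneg_same_limits_const[OF tn _ _ 1] \<Lambda>_neg by (simp add: a_def)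
      then have "p = [:a:]" by (rule const)
      then show False using nonconst 1 by auto
    next
      case 2
      define b where "b = coeff p 1"
      have "coeff p 0 = 0" using 2(1) by (simp add: a_def poly_0_coeff_0)
      moreover have "coeff p k = 0" if "2 \<le> k" for k using 2(2) that by (intro coeff_eq_0) simp
      ultimately have p: "p = [:0, b:]"
        by (intro poly_eqI) (auto simp: b_def coeff_pCons numeral_2_eq_2 split: nat.splits)
      have "0 \<le> poly p (\<Lambda> x1)" using tn by (rule totally_nonneg_nonneg)
      then have "0 \<le> b" using \<Lambda>x1 by (simp add: p zero_le_mult_iff)
      then consider "b = 0" | "0 < b" by linarith
      then show False
      proof cases
        case 1
        then have "p = [:0:]" using p by simp
        then show False using nonconst by blast
      next
        case 2
        then show False using hom p by (auto simp: homothetic_poly_def mult.commute)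
      qed
    next
      case 3
      have p0: "coeff p 0 = 0" using 3(1) by (simp add: a_def poly_0_coeff_0)
      \<comment> \<open>Were the composition zero everywhere, \<open>p\<close> would be the constant
        0, which is excluded here.\<close>
      obtain x where "poly p (\<Lambda> x) \<noteq> 0" using const[of 0] nonconst by force
      then have "\<not> totally_nonneg (\<lambda>x. poly p (hypo_exp_sum \<beta> UNIV x))"
        unfolding \<Lambda> by (rule not_totally_nonneg_poly_hypo_exp_sum[OF assms \<beta>_pos inj inj\<beta> 3(2) p0])
      then show False using tn by (simp add: \<Lambda>)
    qed
  qed
  show "\<not> polya_frequency_function (\<lambda>x. poly p (hypoexp_density \<alpha> x))"
  proof (cases "\<exists>c. 0 \<le> c \<and> p = [:c:]")
    \<comment> \<open>The constants set aside in the first claim are either zero everywhere or not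
      integrable.\<close>
    case True
    then show ?thesis using not_polya_frequency_function_const by auto
  next
    case False
    then show ?thesis using not_tn by (simp add: polya_frequency_function_def)
  qed
qed

end
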